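(* Let $\theta_1,\theta_2>0$ and $\theta:=\theta_1+\theta_2$. (i) There exists $u\in\mathrm{Lip}(\Omega)\setminus S(\Omega)$ with $0<\mathcal{E}_{1+\theta}^{\theta_1,\theta_2}(u)<\infty$ and $\mu[u]\ne 0$. (ii) There exists $u\in L^\infty(\Omega)\setminus S(\Omega)$ with $0<\mathcal{E}_{2}^{\theta_1,\theta_2}(u)<\infty$ and $\mu[u]\neq 0$.
   Context: Setting: $n_1,n_2\ge 1$, $n=n_1+n_2$, $\mathbf{R}^n=X_1\oplus X_2$ with $X_1\perp X_2$ and $\dim X_l=n_l$; each $x\in\mathbf{R}^n$ is written $x=x_1+x_2$ with $x_l\in X_l$. For $l=1,2$, $\Omega_l\subset X_l$ is a non-empty bounded connected open subset of $X_l$, and $\Omega:=\Omega_1+\Omega_2\subset\mathbf{R}^n$. $L(U)$ denotes the space of real-valued Lebesgue-measurable functions on $U$. The set $S(\Omega)$ consists of all $u\in L(\Omega)$ such that for $l=1$ or $l=2$ there is $u_l\in L(\Omega_l)$ with $u(x)=u_l(x_l)$ for almost every $x\in\Omega$. $\mathrm{Lip}(\Omega)$ is the space of Lipschitz continuous functions. For $u\in L^1_{loc}(\Omega)$, $\mu[u]:=\nabla_1\nabla_2u$ is the matrix-valued distribution of mixed second derivatives, where $\nabla_l$ is the distributional gradient with respect to the variables in $X_l$. Kernel: $\rho\in L^1(\mathbf{R}^n,[0,\infty))$ is a fixed radial function with $\int\rho=1$ and $\operatorname{supp}\rho\subset B_1$; $\rho_\varepsilon(z):=\varepsilon^{-n}\rho(z/\varepsilon)$.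 Energies: for $\varepsilon>0$, $\Omega_l^\varepsilon:=\bigcap_{z_l\in X_l,\,|z_l|<\varepsilon}(\Omega_l-z_l)$ and $\Omega^\varepsilon:=\Omega_1^\varepsilon+\Omega_2^\varepsilon$. For $p,\theta_1,\theta_2>0$ and $u\in L(\Omega)$, $$\mathcal{E}_{\varepsilon,p}^{\theta_1,\theta_2}(u):=\int_{\mathbf{R}^n}\rho_\varepsilon(z)\int_{\Omega^\varepsilon}\frac{|u(x+z_1)-u(x)|^{\theta_1}\,|u(x+z_2)-u(x)|^{\theta_2}}{|z|^p}\,dx\,dz,\qquad \mathcal{E}_p^{\theta_1,\theta_2}(u):=\liminf_{\varepsilon\downarrow 0}\mathcal{E}_{\varepsilon,p}^{\theta_1,\theta_2}(u).$$ *)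

theory Defs
  imports "HOL-Analysis.Analysis" "HOL-Library.Set_Algebras"
begin

section \<open>Orthogonal decomposition and Lebesgue measure on a subspace\<close>

text \<open>The summand in \<open>X\<close> of \<open>x\<close> with respect to a direct sum decomposition \<open>X \<oplus> Y\<close>.\<close>

definition component :: "'a::euclidean_space set \<Rightarrow> 'a set \<Rightarrow> 'a \<Rightarrow> 'a" where
  "component X Y x = (THE y. y \<in> X \<and> x - y \<in> Y)"

lemma component_eqI:
  fixes X Y :: "'a::euclidean_space set"
  assumes "subspace X" "subspace Y" and orth: "\<And>x y. x \<in> X \<Longrightarrow> y \<in> Y \<Longrightarrow> orthogonal x y"
    and "a \<in> X" "b \<in> Y"
  shows "component X Y (a + b) = a"
  unfolding component_def
proof (rule the_equality)
  show "a \<in> X \<and> a + b - a \<in> Y" using assms by simp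
next
  fix y assume y: "y \<in> X \<and> a + b - y \<in> Y"
  have "y - a \<in> X" using y assms by (simp add: subspace_diff)
  moreover have "b - (a + b - y) \<in> Y" using y assms by (meson subspace_diff)
  hence "y - a \<in> Y" by simp
  ultimately have "orthogonal (y - a) (y - a)" by (rule orth)
  thus "y = a" by (simp add: orthogonal_def)
qed

definition orthonormal_basis :: "'a::euclidean_space set \<Rightarrow> 'a set \<Rightarrow> bool" where
  "orthonormal_basis X B \<longleftrightarrow>
     B \<subseteq> X \<and> pairwise orthogonal B \<and> (\<forall>b\<in>B. norm b = 1) \<and> span B = X"

lemma orthonormal_basis_exists:
  "subspace X \<Longrightarrow> \<exists>B. orthonormal_basis X B"
  unfolding orthonormal_basis_def by (metis orthonormal_basis_subspace)

text \<open>The construction mirrors that of \<open>lborel\<close>, with an orthonormal basis of \<open>X\<close> in place of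
  \<open>Basis\<close>. The result lives on the Borel sets of the ambient space and is concentrated on \<open>X\<close>. By
  rotation invariance it does not depend on the basis that is picked.\<close>

definition subspace_lborel :: "'a::euclidean_space set \<Rightarrow> 'a measure" where
  "subspace_lborel X =
     (let B = (SOME B. orthonormal_basis X B)
      in distr (\<Pi>\<^sub>M b\<in>B. lborel) borel (\<lambda>f. \<Sum>b\<in>B. f b *\<^sub>R b))"

definition subspace_lebesgue_on :: "'a::euclidean_space set \<Rightarrow> 'a set \<Rightarrow> 'a measure" where
  "subspace_lebesgue_on X U = restrict_space (completion (subspace_lborel X)) U"

section \<open>Function spaces\<close>

text \<open>Functions on a subset \<open>U\<close> are total functions whose values outside \<open>U\<close> are never used.\<close>

definition Lmeas :: "'a::euclidean_space set \<Rightarrow> ('a \<Rightarrow> real) set" where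
  "Lmeas U = borel_measurable (lebesgue_on U)"

definition Lmeas_sub :: "'a::euclidean_space set \<Rightarrow> 'a set \<Rightarrow> ('a \<Rightarrow> real) set" where
  "Lmeas_sub X U = borel_measurable (subspace_lebesgue_on X U)"

definition Linfty :: "'a::euclidean_space set \<Rightarrow> ('a \<Rightarrow> real) set" where
  "Linfty U = {u \<in> Lmeas U. \<exists>C. AE x in lebesgue_on U. \<bar>u x\<bar> \<le> C}"

definition Lip :: "'a::euclidean_space set \<Rightarrow> ('a \<Rightarrow> real) set" where
  "Lip U = {u. \<exists>C. C-lipschitz_on U u}"

definition S_space ::
    "'a::euclidean_space set \<Rightarrow> 'a set \<Rightarrow> 'a set \<Rightarrow> 'a set \<Rightarrow> ('a \<Rightarrow> real) set" where
  "S_space X1 X2 \<Omega>1 \<Omega>2 =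
     {u \<in> Lmeas (\<Omega>1 + \<Omega>2).
        (\<exists>u1 \<in> Lmeas_sub X1 \<Omega>1. AE x in lebesgue_on (\<Omega>1 + \<Omega>2). u x = u1 (component X1 X2 x)) \<or>
        (\<exists>u2 \<in> Lmeas_sub X2 \<Omega>2. AE x in lebesgue_on (\<Omega>1 + \<Omega>2). u x = u2 (component X2 X1 x))}"

section \<open>Distributions\<close>

definition dir_deriv :: "'a::euclidean_space \<Rightarrow> ('a \<Rightarrow> real) \<Rightarrow> 'a \<Rightarrow> real" where
  "dir_deriv v f x = frechet_derivative f (at x) v"

primrec Ck :: "nat \<Rightarrow> ('a::euclidean_space \<Rightarrow> real) \<Rightarrow> bool" where
  "Ck 0 f \<longleftrightarrow> continuous_on UNIV f"
| "Ck (Suc k) f \<longleftrightarrow> (\<forall>x. f differentiable (at x)) \<and> (\<forall>v. Ck k (dir_deriv v f))"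

text \<open>Elements of \<open>C\<^sub>c\<^sup>\<infinity>(U)\<close>, extended by zero to the whole space.\<close>

definition test_function :: "'a::euclidean_space set \<Rightarrow> ('a \<Rightarrow> real) \<Rightarrow> bool" where
  "test_function U \<phi> \<longleftrightarrow>
     (\<forall>k. Ck k \<phi>) \<and> compact (closure {x. \<phi> x \<noteq> 0}) \<and> closure {x. \<phi> x \<noteq> 0} \<subseteq> U"

text \<open>Distributions on \<open>U\<close> are represented as functionals of which only the values on test functions
  on \<open>U\<close> matter.\<close>

definition regular_dist :: "'a::euclidean_space set \<Rightarrow> ('a \<Rightarrow> real) \<Rightarrow> ('a \<Rightarrow> real) \<Rightarrow> real" where
  "regular_dist U u = (\<lambda>\<phi>. LINT x:U|lebesgue. u x * \<phi> x)"

definition dist_deriv ::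
    "'a::euclidean_space \<Rightarrow> (('a \<Rightarrow> real) \<Rightarrow> real) \<Rightarrow> ('a \<Rightarrow> real) \<Rightarrow> real" where
  "dist_deriv v T = (\<lambda>\<phi>. - T (dir_deriv v \<phi>))"

text \<open>\<open>mu U u v w\<close>, for \<open>v \<in> X\<^sub>1\<close> and \<open>w \<in> X\<^sub>2\<close>, is the contraction of the matrix-valued distribution
  \<open>\<nabla>\<^sub>1\<nabla>\<^sub>2u\<close> with \<open>v\<close> and \<open>w\<close>; its matrix entries are obtained from orthonormal bases of \<open>X\<^sub>1\<close> and \<open>X\<^sub>2\<close>.\<close>

definition mu ::
    "'a::euclidean_space set \<Rightarrow> ('a \<Rightarrow> real) \<Rightarrow> 'a \<Rightarrow> 'a \<Rightarrow> ('a \<Rightarrow> real) \<Rightarrow> real" where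
  "mu U u v w = dist_deriv v (dist_deriv w (regular_dist U u))"

definition mu_nonzero ::
    "'a::euclidean_space set \<Rightarrow> 'a set \<Rightarrow> 'a set \<Rightarrow> ('a \<Rightarrow> real) \<Rightarrow> bool" where
  "mu_nonzero X1 X2 U u \<longleftrightarrow>
     (\<exists>v\<in>X1. \<exists>w\<in>X2. \<exists>\<phi>. test_function U \<phi> \<and> mu U u v w \<phi> \<noteq> 0)"

section \<open>Kernel and energies\<close>

text \<open>The support of an element of \<open>L\<^sup>1\<close>: the complement of the largest open set on which the function
  vanishes almost everywhere.\<close>

definition ess_support :: "('a::euclidean_space \<Rightarrow> real) \<Rightarrow> 'a set" where
  "ess_support f = - \<Union>{U. open U \<and> (AE x in lebesgue. x \<in> U \<longrightarrow> f x = 0)}"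

definition radial :: "('a::euclidean_space \<Rightarrow> real) \<Rightarrow> bool" where
  "radial f \<longleftrightarrow> (\<forall>x y. norm x = norm y \<longrightarrow> f x = f y)"

definition radial_kernel :: "('a::euclidean_space \<Rightarrow> real) \<Rightarrow> bool" where
  "radial_kernel \<rho> \<longleftrightarrow> integrable lebesgue \<rho> \<and> (\<forall>z. 0 \<le> \<rho> z) \<and> radial \<rho> \<and>
     integral\<^sup>L lebesgue \<rho> = 1 \<and> ess_support \<rho> \<subseteq> ball 0 1"

definition rescale :: "('a::euclidean_space \<Rightarrow> real) \<Rightarrow> real \<Rightarrow> 'a \<Rightarrow> real" where
  "rescale \<rho> \<epsilon> z = \<rho> (z /\<^sub>R \<epsilon>) / \<epsilon> ^ DIM('a)"

definition shrink :: "'a::euclidean_space set \<Rightarrow> 'a set \<Rightarrow> real \<Rightarrow> 'a set" where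
  "shrink X U \<epsilon> = (\<Inter>z\<in>{z \<in> X. norm z < \<epsilon>}. (\<lambda>x. x - z) ` U)"

definition energy_eps ::
    "'a::euclidean_space set \<Rightarrow> 'a set \<Rightarrow> 'a set \<Rightarrow> 'a set \<Rightarrow> ('a \<Rightarrow> real) \<Rightarrow>
     real \<Rightarrow> real \<Rightarrow> real \<Rightarrow> real \<Rightarrow> ('a \<Rightarrow> real) \<Rightarrow> ennreal" where
  "energy_eps X1 X2 \<Omega>1 \<Omega>2 \<rho> \<theta>1 \<theta>2 p \<epsilon> u =
     (\<integral>\<^sup>+z. ennreal (rescale \<rho> \<epsilon> z) *
        (\<integral>\<^sup>+x\<in>shrink X1 \<Omega>1 \<epsilon> + shrink X2 \<Omega>2 \<epsilon>.
           ennreal (\<bar>u (x + component X1 X2 z) - u x\<bar> powr \<theta>1 *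
                    \<bar>u (x + component X2 X1 z) - u x\<bar> powr \<theta>2 / norm z powr p) \<partial>lebesgue)
        \<partial>lebesgue)"

definition energy ::
    "'a::euclidean_space set \<Rightarrow> 'a set \<Rightarrow> 'a set \<Rightarrow> 'a set \<Rightarrow> ('a \<Rightarrow> real) \<Rightarrow>
     real \<Rightarrow> real \<Rightarrow> real \<Rightarrow> ('a \<Rightarrow> real) \<Rightarrow> ennreal" where
  "energy X1 X2 \<Omega>1 \<Omega>2 \<rho> \<theta>1 \<theta>2 p u =
     Liminf (at_right 0) (\<lambda>\<epsilon>. energy_eps X1 X2 \<Omega>1 \<Omega>2 \<rho> \<theta>1 \<theta>2 p \<epsilon> u)"

end

theory Submission
  imports Defs
begin

text \<open>
  Fix unit vectors \<open>e \<in> X1\<close> and \<open>f \<in> X2\<close> and a point \<open>x0\<close> of the domain, and let \<open>s = (x - x0) \<bullet> e\<close> and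
  \<open>t = (x - x0) \<bullet> f\<close>. The witnesses are \<open>min s t\<close> for the Lipschitz part and the indicator of the quadrant
  \<open>s > 0\<close>, \<open>t > 0\<close> for the bounded part.

  A shift \<open>z\<close> changes \<open>min s t\<close> by at most \<open>norm z\<close> in either component, and both partial increments are
  nonzero only if \<open>\<bar>s - t\<bar> \<le> norm z\<close>, which is a slab of measure of order \<open>norm z\<close>. So the integral over
  \<open>x\<close> of the product of their powers is at most of order \<open>norm z powr (\<theta> + 1)\<close>. For the quadrant the
  increments have absolute value at most \<open>1\<close>, and both are nonzero only if \<open>\<bar>s\<bar>\<close> and \<open>\<bar>t\<bar>\<close> are at most
  \<open>norm z\<close>, a set of measure of order \<open>norm z powr 2\<close>. In both cases a lower bound of the same order holds
  for small \<open>z\<close> such that \<open>z \<bullet> e\<close> and \<open>z \<bullet> f\<close> are negative and comparable to \<open>norm z\<close>. These directions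
  form an open cone, on which a radial kernel of mass \<open>1\<close> has positive mass
  (\<open>nn_integral_radial_kernel_cone_pos\<close>). The measures of slabs and squares are estimated by averaging
  over translates (\<open>emeasure_preimage_le\<close>, \<open>emeasure_preimage_ge\<close>). Together this gives
  \<open>energy_finite_pos\<close>.

  Both witnesses have nonnegative mixed second differences in the directions \<open>e\<close> and \<open>f\<close>, which are
  positive on a nonempty open set. This excludes a function of one component alone (\<open>not_in_S_space\<close>),
  and, after pairing with translates of a smooth bump, it excludes a vanishing mixed distributional
  derivative (\<open>mu_nonzero_if_mixed_diff_nonneg\<close>).
\<close>

section \<open>Smooth bump functions\<close>

text \<open>The functions \<open>exp (-1/t) / t\<^sup>n\<close> on the positive half-line, extended by \<open>0\<close>. Their linear span is
  closed under differentiation, so all of them are smooth.\<close>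

definition flat :: "nat \<Rightarrow> real \<Rightarrow> real" where
  "flat n t = (if t > 0 then exp (- 1 / t) / t ^ n else 0)"

lemma flat_nonneg: "0 \<le> flat n t"
  by (simp add: flat_def)

lemma flat_pos_iff: "0 < flat n t \<longleftrightarrow> 0 < t"
  by (simp add: flat_def)

lemma flat_tendsto_0: "(flat n \<longlongrightarrow> 0) (at 0)"
proof -
  have "((\<lambda>x::real. x ^ n / exp x) \<longlongrightarrow> 0) at_top"
    by (rule tendsto_power_div_exp_0)
  then have "((\<lambda>t::real. (inverse t) ^ n / exp (inverse t)) \<longlongrightarrow> 0) (at_right 0)"
    by (rule filterlim_compose[OF _ filterlim_inverse_at_top_right])
  moreover have "\<forall>\<^sub>F t in at_right 0. (inverse t) ^ n / exp (inverse t) = flat n (t::real)"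
    using eventually_at_right_less[of "0::real"]
    by eventually_elim (simp add: flat_def exp_minus field_simps)
  ultimately have r: "(flat n \<longlongrightarrow> 0) (at_right 0)"
    by (rule Lim_transform_eventually)
  have "\<forall>\<^sub>F t in at_left 0. 0 = flat n (t::real)"
    by (auto simp: flat_def eventually_at_filter)
  then have "(flat n \<longlongrightarrow> 0) (at_left 0)"
    by (rule Lim_transform_eventually[OF tendsto_const])
  with r show ?thesis by (simp add: filterlim_split_at)
qed

lemma flat_has_derivative:
  "(flat n has_real_derivative flat (n + 2) t - real n * flat (n + 1) t) (at t)"
proof -
  consider "t > 0" | "t < 0" | "t = 0" by linarith
  then show ?thesis
  proof cases
    case 1
    have "((\<lambda>s. exp (- 1 / s) / s ^ n) has_real_derivative
        (exp (- 1 / t) * (1 / t\<^sup>2) * t ^ n - exp (- 1 / t) * (real n * t ^ (n - 1))) / (t ^ n * t ^ n)) (at t)"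
      using 1 by (auto intro!: derivative_eq_intros simp: power2_eq_square)
    also have "real n * t ^ (n - 1) = real n * t ^ n / t"
      using 1 by (cases n) auto
    also have "(exp (- 1 / t) * (1 / t\<^sup>2) * t ^ n - exp (- 1 / t) * (real n * t ^ n / t)) / (t ^ n * t ^ n)
        = flat (n + 2) t - real n * flat (n + 1) t"
      using 1 by (simp add: flat_def field_simps power2_eq_square)
    finally have "((\<lambda>s. exp (- 1 / s) / s ^ n) has_real_derivative
        flat (n + 2) t - real n * flat (n + 1) t) (at t)" .
    then show ?thesis
      by (rule has_field_derivative_transform_within_open[of _ _ _ "{0<..}"])
         (use 1 in \<open>auto simp: flat_def\<close>)
  next
    case 2
    have "((\<lambda>s. 0) has_real_derivative flat (n + 2) t - real n * flat (n + 1) t) (at t)"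
      using 2 by (simp add: flat_def)
    then show ?thesis
      by (rule has_field_derivative_transform_within_open[of _ _ _ "{..<0}"])
         (use 2 in \<open>auto simp: flat_def\<close>)
  next
    case 3
    \<comment> \<open>The difference quotient of \<open>flat n\<close> at \<open>0\<close> is \<open>flat (n + 1)\<close>.\<close>
    have "((\<lambda>h. (flat n (0 + h) - flat n 0) / h) \<longlongrightarrow> 0) (at 0)"
      by (rule Lim_transform_eventually[OF flat_tendsto_0[of "Suc n"]])
         (auto simp: flat_def eventually_at_filter)
    then show ?thesis using 3 by (simp add: DERIV_def flat_def)
  qed
qed

lemma dir_deriv_eqI: "(g has_derivative g') (at x) \<Longrightarrow> dir_deriv v g x = g' v"
  unfolding dir_deriv_def using frechet_derivative_at by metis

lemma Ck_Suc_imp_Ck: "Ck (Suc k) g \<Longrightarrow> Ck k g"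
proof (induction k arbitrary: g)
  case 0
  then show ?case
    by (auto intro!: continuous_at_imp_continuous_on differentiable_imp_continuous_within)
qed auto

lemma Ck_const: "Ck k (\<lambda>x. c)"
proof (induction k arbitrary: c)
  case (Suc k)
  have "dir_deriv v (\<lambda>x::'a. c) = (\<lambda>x. 0)" for v
    by (rule ext, rule dir_deriv_eqI[where g' = "\<lambda>_. 0"]) (rule has_derivative_const)
  with Suc show ?case by simp
qed simp

lemma Ck_add: "Ck k g \<Longrightarrow> Ck k h \<Longrightarrow> Ck k (\<lambda>x. g x + h x)"
proof (induction k arbitrary: g h)
  case (Suc k)
  have "dir_deriv v (\<lambda>x. g x + h x) = (\<lambda>x. dir_deriv v g x + dir_deriv v h x)" for v
    using Suc.prems
    by (intro ext dir_deriv_eqI[where g' = "\<lambda>v. dir_deriv v g _ + dir_deriv v h _"])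
       (auto intro!: has_derivative_add simp: dir_deriv_def frechet_derivative_works[symmetric])
  with Suc show ?case by simp
qed (auto intro: continuous_on_add)

lemma Ck_mult: "Ck k g \<Longrightarrow> Ck k h \<Longrightarrow> Ck k (\<lambda>x. g x * h x)"
proof (induction k arbitrary: g h)
  case (Suc k)
  have "dir_deriv v (\<lambda>x. g x * h x) = (\<lambda>x. g x * dir_deriv v h x + dir_deriv v g x * h x)" for v
    using Suc.prems
    by (intro ext dir_deriv_eqI[where g' = "\<lambda>v. g _ * dir_deriv v h _ + dir_deriv v g _ * h _"])
       (auto intro!: has_derivative_mult simp: dir_deriv_def frechet_derivative_works[symmetric])
  moreover have "Ck k g" "Ck k h" using Suc.prems by (auto intro: Ck_Suc_imp_Ck simp del: Ck.simps)
  ultimately show ?case using Suc by (auto intro!: Ck_add)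
qed (auto intro: continuous_on_mult)

lemma Ck_inner: "Ck k (\<lambda>x. (x - a) \<bullet> v)"
proof (cases k)
  case (Suc m)
  have "dir_deriv w (\<lambda>x. (x - a) \<bullet> v) = (\<lambda>x. w \<bullet> v)" for w
    by (rule ext, rule dir_deriv_eqI[where g' = "\<lambda>w. w \<bullet> v"]) (auto intro!: derivative_eq_intros)
  with Suc show ?thesis by (auto simp: Ck_const)
qed (auto intro!: continuous_intros)

lemma Ck_flat: "Ck k (\<lambda>x::'a::euclidean_space. flat n (R - (x - a) \<bullet> (x - a)))"
proof (induction k arbitrary: n)
  case 0
  have "continuous_on UNIV (flat n)"
    by (auto intro!: continuous_at_imp_continuous_on DERIV_isCont[OF flat_has_derivative])
  then show ?case
    by (auto intro!: continuous_on_compose2[of UNIV "flat n"] continuous_intros)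
next
  case (Suc k)
  let ?q = "\<lambda>x::'a. R - (x - a) \<bullet> (x - a)"
  have D: "((\<lambda>x. flat n (?q x)) has_derivative
      (\<lambda>v. (flat (n + 2) (?q x) + - real n * flat (n + 1) (?q x)) * (- 2 * ((x - a) \<bullet> v)))) (at x)" for x
  proof -
    have "(?q has_derivative (\<lambda>v. - 2 * ((x - a) \<bullet> v))) (at x)"
      by (auto intro!: derivative_eq_intros simp: inner_commute)
    from has_derivative_compose[OF this flat_has_derivative[of n "?q x", unfolded has_field_derivative_def]]
    show ?thesis by simp
  qed
  have "dir_deriv v (\<lambda>x. flat n (?q x)) =
     (\<lambda>x. (flat (n + 2) (?q x) + - real n * flat (n + 1) (?q x)) * (- 2 * ((x - a) \<bullet> v)))" for v
    using dir_deriv_eqI[OF D] by auto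
  moreover have "(\<lambda>x. flat n (?q x)) differentiable (at x)" for x
    using D differentiable_def by blast
  moreover have "Ck k (\<lambda>x. (flat (n + 2) (?q x) + - real n * flat (n + 1) (?q x)) * (- 2 * ((x - a) \<bullet> v)))" for v
    by (intro Ck_add Ck_mult Ck_const Ck_inner Suc)
  ultimately show ?case by (simp only: Ck.simps) blast
qed

lemma Ck_shift: "Ck k g \<Longrightarrow> Ck k (\<lambda>x. g (x - w))"
  and dir_deriv_shift: "(\<And>x. g differentiable (at x)) \<Longrightarrow> dir_deriv v (\<lambda>x. g (x - w)) = (\<lambda>x. dir_deriv v g (x - w))"
proof -
  have *: "((\<lambda>x. g (x - w)) has_derivative (\<lambda>v. dir_deriv v g (x - w))) (at x)"
    if "\<And>x. g differentiable (at x)" for x and g :: "'a \<Rightarrow> real"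
  proof -
    have "(g has_derivative (\<lambda>v. dir_deriv v g (x - w))) (at (x - w))"
      using that by (auto simp: dir_deriv_def frechet_derivative_works[symmetric])
    moreover have "((\<lambda>x. x - w) has_derivative (\<lambda>v. v)) (at x)"
      by (auto intro!: derivative_eq_intros)
    ultimately show ?thesis
      using has_derivative_compose[of "\<lambda>x. x - w" "\<lambda>v. v" x UNIV g "\<lambda>v. dir_deriv v g (x - w)"] by simp
  qed
  have **: "dir_deriv v (\<lambda>x. g (x - w)) = (\<lambda>x. dir_deriv v g (x - w))"
    if "\<And>x. g differentiable (at x)" for v and g :: "'a \<Rightarrow> real"
    using dir_deriv_eqI[OF *] that by auto
  show "(\<And>x. g differentiable (at x)) \<Longrightarrow> dir_deriv v (\<lambda>x. g (x - w)) = (\<lambda>x. dir_deriv v g (x - w))"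
    by (rule **)
  show "Ck k g \<Longrightarrow> Ck k (\<lambda>x. g (x - w))"
  proof (induction k arbitrary: g)
    case 0
    then show ?case by (auto intro!: continuous_on_compose2[of UNIV g] continuous_intros)
  next
    case (Suc k)
    then show ?case using * ** by (auto simp: differentiable_def)
  qed
qed

text \<open>For \<open>r > 0\<close>, a smooth function that is positive on the ball of radius \<open>r\<close> about \<open>a\<close> and \<open>0\<close>
  elsewhere.\<close>

definition bump :: "'a::euclidean_space \<Rightarrow> real \<Rightarrow> 'a \<Rightarrow> real" where
  "bump a r x = flat 0 (r\<^sup>2 - (x - a) \<bullet> (x - a))"

lemma bump_nonneg: "0 \<le> bump a r x"
  by (simp add: bump_def flat_nonneg)

lemma bump_pos_iff: "0 < r \<Longrightarrow> 0 < bump a r x \<longleftrightarrow> x \<in> ball a r"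
proof -
  assume "0 < r"
  then have "(x - a) \<bullet> (x - a) < r\<^sup>2 \<longleftrightarrow> norm (x - a) < r"
    by (metis dot_square_norm norm_ge_zero power_mono_iff not_less less_imp_le zero_less_numeral)
  then show ?thesis by (auto simp: bump_def flat_pos_iff dist_norm norm_minus_commute)
qed

lemma Ck_bump: "Ck k (bump a r)"
  unfolding bump_def[abs_def] by (rule Ck_flat)

lemma test_function_if_supported_cball:
  assumes "\<And>k. Ck k g" "\<And>x. x \<notin> cball a r \<Longrightarrow> g x = 0" "cball a r \<subseteq> U"
  shows "test_function U g"
proof -
  have "closure {x. g x \<noteq> 0} \<subseteq> cball a r"
    by (rule closure_minimal) (use assms(2) in \<open>blast, simp\<close>)
  then have "bounded {x. g x \<noteq> 0}"
    using bounded_subset[OF bounded_cball] closure_subset by (metis subset_trans)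
  with \<open>closure {x. g x \<noteq> 0} \<subseteq> cball a r\<close> assms show ?thesis
    unfolding test_function_def by (auto simp: compact_closure)
qed

section \<open>Lebesgue measure of preimages under linear maps\<close>

lemma nn_integral_lborel_translate:
  fixes c :: "'a::euclidean_space"
  assumes [measurable]: "g \<in> borel_measurable borel"
  shows "(\<integral>\<^sup>+x. g (x + c) \<partial>lborel) = (\<integral>\<^sup>+x. g x \<partial>lborel)"
proof -
  have "(\<integral>\<^sup>+x. g x \<partial>lborel) = (\<integral>\<^sup>+x. g x \<partial>(distr lborel borel ((+) c)))"
    by (simp add: lborel_distr_plus)
  also have "\<dots> = (\<integral>\<^sup>+x. g (c + x) \<partial>lborel)"
    by (rule nn_integral_distr) auto
  finally show ?thesis by (simp add: add.commute)
qed

text \<open>Tonelli and translation invariance: averaging the measure of \<open>A\<close> over the translates by \<open>L p\<close>,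
  \<open>p \<in> J\<close>, computes it from the sizes of the fibres of \<open>A\<close> in direction \<open>L\<close>.\<close>

lemma emeasure_average_translates:
  fixes L :: "'b::euclidean_space \<Rightarrow> 'a::euclidean_space"
  assumes "linear L" and [measurable]: "A \<in> sets borel" "J \<in> sets borel"
  shows "emeasure lborel J * emeasure lborel A = (\<integral>\<^sup>+x. emeasure lborel {p \<in> J. x - L p \<in> A} \<partial>lborel)"
proof -
  have [measurable]: "L \<in> borel_measurable borel"
    using assms(1) by (simp add: linear_continuous_on linear_conv_bounded_linear borel_measurable_continuous_onI)
  have "emeasure lborel {p \<in> J. x - L p \<in> A}
      = (\<integral>\<^sup>+p. indicator J p * indicator A (x - L p) \<partial>lborel)" for x
  proof -
    have [measurable]: "{p \<in> J. x - L p \<in> A} \<in> sets borel" by measurable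
    have "emeasure lborel {p \<in> J. x - L p \<in> A} = (\<integral>\<^sup>+p. indicator {p \<in> J. x - L p \<in> A} p \<partial>lborel)"
      by simp
    also have "\<dots> = (\<integral>\<^sup>+p. indicator J p * indicator A (x - L p) \<partial>lborel)"
      by (rule nn_integral_cong) (auto simp: indicator_def)
    finally show ?thesis .
  qed
  then have "(\<integral>\<^sup>+x. emeasure lborel {p \<in> J. x - L p \<in> A} \<partial>lborel)
      = (\<integral>\<^sup>+x. (\<integral>\<^sup>+p. indicator J p * indicator A (x - L p) \<partial>lborel) \<partial>lborel)" by simp
  also have "\<dots> = (\<integral>\<^sup>+p. (\<integral>\<^sup>+x. indicator J p * indicator A (x - L p) \<partial>lborel) \<partial>lborel)"
    by (rule lborel_pair.Fubini') measurable
  also have "\<dots> = (\<integral>\<^sup>+p. indicator J p * emeasure lborel A \<partial>lborel)"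
  proof (rule nn_integral_cong)
    fix p
    have "(\<integral>\<^sup>+x. indicator J p * indicator A (x - L p) \<partial>lborel)
        = indicator J p * (\<integral>\<^sup>+x. indicator A (x + - L p) \<partial>lborel)"
      by (simp add: nn_integral_cmult)
    also have "\<dots> = indicator J p * emeasure lborel A"
      by (subst nn_integral_lborel_translate) auto
    finally show "(\<integral>\<^sup>+x. indicator J p * indicator A (x - L p) \<partial>lborel) = indicator J p * emeasure lborel A" .
  qed
  also have "\<dots> = emeasure lborel J * emeasure lborel A"
    by (simp add: nn_integral_multc)
  finally show ?thesis by simp
qed

lemma emeasure_lborel_reflect_translate:
  fixes Q :: "'b::euclidean_space set"
  assumes [measurable]: "Q \<in> sets borel"
  shows "emeasure lborel {p. y - p \<in> Q} = emeasure lborel Q"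
proof -
  have "emeasure lborel Q = emeasure (density (distr lborel borel (\<lambda>x. y + (-1) *\<^sub>R x)) (\<lambda>_. 1)) Q"
    using lborel_affine[of "-1" y] by simp
  also have "\<dots> = emeasure lborel {p. y - p \<in> Q}"
    by (simp add: density_1 emeasure_distr vimage_def)
  finally show ?thesis by simp
qed

text \<open>The push-forward of Lebesgue measure on a ball under a linear surjection \<open>l\<close> with right inverse \<open>L\<close>
  is bounded by a multiple of Lebesgue measure, and near \<open>0\<close> it dominates a positive multiple. Averaging
  over translates in the directions of \<open>L\<close> gives this without coordinates adapted to \<open>l\<close>.\<close>

context
  fixes l :: "'a::euclidean_space \<Rightarrow> 'b::euclidean_space" and L :: "'b \<Rightarrow> 'a"
  assumes l: "linear l" and L: "linear L" and lL: "\<And>y. l (L y) = y"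
begin

lemma sets_preimage_ball:
  assumes [measurable]: "Q \<in> sets borel"
  shows "{x \<in> ball a R. l (x - a) \<in> Q} \<in> sets borel"
proof -
  have [measurable]: "l \<in> borel_measurable borel"
    using l by (simp add: linear_continuous_on linear_conv_bounded_linear borel_measurable_continuous_onI)
  show ?thesis by measurable
qed

lemma emeasure_preimage_le:
  shows "\<exists>C\<ge>0. \<forall>Q\<in>sets borel.
    emeasure lborel {x \<in> ball a R. l (x - a) \<in> Q} \<le> ennreal C * emeasure lborel Q"
proof -
  obtain K where K: "K > 0" "\<And>y. norm (L y) \<le> norm y * K"
    using L linear_conv_bounded_linear bounded_linear.pos_bounded by blast
  let ?J = "ball (0::'b) 1"
  define J where "J = measure lborel ?J"
  have eJ: "emeasure lborel ?J = ennreal J" 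
    unfolding J_def by (intro emeasure_eq_ennreal_measure) (metis emeasure_lborel_ball_finite infinity_ennreal_def less_irrefl)
  have "J > 0" unfolding J_def using content_ball_pos[of 1 "0::'b"] by simp
  define B where "B = measure lborel (ball a (R + K))"
  have eB: "emeasure lborel (ball a (R + K)) = ennreal B"
    unfolding B_def by (intro emeasure_eq_ennreal_measure) (metis emeasure_lborel_ball_finite infinity_ennreal_def less_irrefl)
  show ?thesis
  proof (intro exI[of _ "B / J"] conjI ballI)
    show "0 \<le> B / J" using \<open>J > 0\<close> by (simp add: B_def)
    fix Q :: "'b set" assume Q: "Q \<in> sets borel"
    let ?A = "{x \<in> ball a R. l (x - a) \<in> Q}"
    have fib: "emeasure lborel {p \<in> ?J. x - L p \<in> ?A} \<le> emeasure lborel Q * indicator (ball a (R + K)) x" for x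
    proof (cases "x \<in> ball a (R + K)")
      case True
      have "{p \<in> ?J. x - L p \<in> ?A} \<subseteq> {p. l (x - a) - p \<in> Q}"
        using lL l by (auto simp: linear_diff algebra_simps)
      moreover have "{p. l (x - a) - p \<in> Q} \<in> sets borel" using Q by measurable
      ultimately show ?thesis
        using emeasure_mono[of "{p \<in> ?J. x - L p \<in> ?A}" "{p. l (x - a) - p \<in> Q}" lborel] True
        by (simp add: emeasure_lborel_reflect_translate[OF Q])
    next
      case False
      have "norm p < 1 \<Longrightarrow> \<not> dist a (x - L p) < R" for p
      proof
        assume "norm p < 1" "dist a (x - L p) < R"
        moreover have "norm p * K \<le> 1 * K" using \<open>norm p < 1\<close> \<open>K > 0\<close> by (intro mult_right_mono) auto
        moreover have "dist a x \<le> dist a (x - L p) + norm (L p)"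
          using norm_triangle_ineq[of "a - (x - L p)" "- L p"] by (simp add: dist_norm)
        ultimately show False using K(2)[of p] False by simp
      qed
      then have "{p \<in> ?J. x - L p \<in> ?A} = {}" by (auto simp: dist_norm)
      then show ?thesis by (metis emeasure_empty zero_le)
    qed
    have "ennreal J * emeasure lborel ?A = (\<integral>\<^sup>+x. emeasure lborel {p \<in> ?J. x - L p \<in> ?A} \<partial>lborel)"
      using emeasure_average_translates[OF L sets_preimage_ball[OF Q], of ?J a R] eJ by simp
    also have "\<dots> \<le> (\<integral>\<^sup>+x. emeasure lborel Q * indicator (ball a (R + K)) x \<partial>lborel)"
      by (rule nn_integral_mono) (rule fib)
    also have "\<dots> = ennreal B * emeasure lborel Q"
      by (subst nn_integral_cmult_indicator) (simp_all add: eB mult.commute)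
    finally have *: "ennreal J * emeasure lborel ?A \<le> ennreal B * emeasure lborel Q" .
    have "emeasure lborel ?A = ennreal (1 / J) * (ennreal J * emeasure lborel ?A)"
      using \<open>J > 0\<close> by (simp add: mult.assoc[symmetric] ennreal_mult[symmetric])
    also have "\<dots> \<le> ennreal (1 / J) * (ennreal B * emeasure lborel Q)"
      by (intro mult_left_mono *) simp
    also have "\<dots> = ennreal (B / J) * emeasure lborel Q"
      using \<open>J > 0\<close> by (simp add: mult.assoc[symmetric] ennreal_mult[symmetric] B_def)
    finally show "emeasure lborel ?A \<le> ennreal (B / J) * emeasure lborel Q" .
  qed
qed

lemma emeasure_preimage_ge:
  assumes "r > 0"
  shows "\<exists>c>0. \<exists>\<eta>>0. \<forall>Q\<in>sets borel. Q \<subseteq> ball 0 \<eta> \<longrightarrow>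
    ennreal c * emeasure lborel Q \<le> emeasure lborel {x \<in> ball a r. l (x - a) \<in> Q}"
proof -
  obtain K where K: "K > 0" "\<And>y. norm (L y) \<le> norm y * K"
    using L linear_conv_bounded_linear bounded_linear.pos_bounded by blast
  \<comment> \<open>Translations by \<open>L p\<close> with \<open>norm p < 2 * \<eta>\<close> move points by at most \<open>r / 2\<close>.\<close>
  define \<eta> where "\<eta> = r / (4 * K)"
  have "\<eta> > 0" using assms K by (simp add: \<eta>_def)
  let ?J = "ball (0::'b) (2 * \<eta>)"
  define J where "J = measure lborel ?J"
  have eJ: "emeasure lborel ?J = ennreal J"
    unfolding J_def by (intro emeasure_eq_ennreal_measure) (metis emeasure_lborel_ball_finite infinity_ennreal_def less_irrefl)
  have "J > 0" unfolding J_def using content_ball_pos[of "2 * \<eta>" "0::'b"] \<open>\<eta> > 0\<close> by simp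
  define W where "W = {x \<in> ball a (r / 2). l (x - a) \<in> ball 0 \<eta>}"
  have cl: "continuous_on UNIV (\<lambda>x. l (x - a))"
  proof -
    have "continuous_on UNIV l"
      using l by (simp add: linear_continuous_on linear_conv_bounded_linear)
    then show ?thesis
      by (rule continuous_on_compose2) (auto intro!: continuous_intros)
  qed
  have "W = ball a (r / 2) \<inter> (\<lambda>x. l (x - a)) -` ball 0 \<eta>" by (auto simp: W_def)
  with cl have oW: "open W" by (simp add: open_Int open_vimage)
  then have [measurable]: "W \<in> sets borel" by simp
  have "a \<in> W" using assms \<open>\<eta> > 0\<close> l by (simp add: W_def linear_0)
  then have "W \<noteq> {}" by auto
  define w where "w = measure lborel W"
  have "emeasure lborel W \<le> emeasure lborel (ball a (r / 2))"
    by (intro emeasure_mono) (auto simp: W_def)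
  then have eW: "emeasure lborel W = ennreal w"
    unfolding w_def by (intro emeasure_eq_ennreal_measure) (metis emeasure_lborel_ball_finite infinity_ennreal_def less_irrefl top.extremum_unique)
  have "emeasure lborel W \<noteq> 0"
  proof
    assume "emeasure lborel W = 0"
    then have "W \<in> null_sets lebesgue" by (auto intro: null_sets_completionI)
    then show False
      using oW \<open>W \<noteq> {}\<close> open_not_negligible by (auto simp: negligible_iff_null_sets)
  qed
  then have "w > 0" unfolding eW by (simp add: w_def less_le)
  show ?thesis
  proof (rule exI[of _ "w / J"], rule conjI, simp add: \<open>J > 0\<close> \<open>w > 0\<close>,
      rule exI[of _ \<eta>], intro conjI ballI impI)
    show "\<eta> > 0" by fact
    fix Q :: "'b set" assume Q: "Q \<in> sets borel" "Q \<subseteq> ball 0 \<eta>"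
    let ?A = "{x \<in> ball a r. l (x - a) \<in> Q}"
    have fib: "emeasure lborel Q * indicator W x \<le> emeasure lborel {p \<in> ?J. x - L p \<in> ?A}" for x
    proof (cases "x \<in> W")
      case True
      have "{p. l (x - a) - p \<in> Q} \<subseteq> {p \<in> ?J. x - L p \<in> ?A}"
      proof safe
        fix p assume p: "l (x - a) - p \<in> Q"
        have "norm (l (x - a) - p) < \<eta>" "norm (l (x - a)) < \<eta>" "dist a x < r / 2"
          using p Q(2) True by (auto simp: W_def)
        then have np: "norm p < 2 * \<eta>"
          using norm_triangle_ineq4[of "l (x - a)" "l (x - a) - p"] by simp
        then show "p \<in> ?J" by simp
        have "norm p * K \<le> 2 * \<eta> * K" using np \<open>K > 0\<close> by (intro mult_right_mono) auto
        also have "\<dots> = r / 2" using \<open>K > 0\<close> by (simp add: \<eta>_def)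
        finally have "norm (L p) \<le> r / 2" using K(2)[of p] by simp
        with \<open>dist a x < r / 2\<close> show "x - L p \<in> ball a r"
          using norm_triangle_ineq[of "a - x" "L p"] by (simp add: dist_norm algebra_simps)
        show "l (x - L p - a) \<in> Q"
          using p lL l by (simp add: linear_diff linear_add algebra_simps)
      qed
      moreover have "L \<in> borel_measurable borel"
        using L by (simp add: linear_continuous_on linear_conv_bounded_linear borel_measurable_continuous_onI)
      then have "{p \<in> ?J. x - L p \<in> ?A} \<in> sets borel"
        using sets_preimage_ball[OF Q(1), of a r] by measurable
      ultimately have "emeasure lborel {p. l (x - a) - p \<in> Q} \<le> emeasure lborel {p \<in> ?J. x - L p \<in> ?A}"
        by (intro emeasure_mono) (simp_all only: sets_lborel)
      with True show ?thesis
        by (simp only: emeasure_lborel_reflect_translate[OF Q(1)] indicator_simps mult_1_right)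
    qed simp
    have "ennreal w * emeasure lborel Q = (\<integral>\<^sup>+x. emeasure lborel Q * indicator W x \<partial>lborel)"
      by (subst nn_integral_cmult_indicator) (simp_all add: eW mult.commute)
    also have "\<dots> \<le> (\<integral>\<^sup>+x. emeasure lborel {p \<in> ?J. x - L p \<in> ?A} \<partial>lborel)"
      by (rule nn_integral_mono) (rule fib)
    also have "\<dots> = ennreal J * emeasure lborel ?A"
      using emeasure_average_translates[OF L sets_preimage_ball[OF Q(1)], of ?J a r] eJ by simp
    finally have *: "ennreal w * emeasure lborel Q \<le> ennreal J * emeasure lborel ?A" .
    have "ennreal (w / J) * emeasure lborel Q = ennreal (1 / J) * (ennreal w * emeasure lborel Q)"
      using \<open>J > 0\<close> \<open>w > 0\<close> by (simp add: mult.assoc[symmetric] ennreal_mult[symmetric])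
    also have "\<dots> \<le> ennreal (1 / J) * (ennreal J * emeasure lborel ?A)"
      by (intro mult_left_mono *) simp
    also have "\<dots> = emeasure lborel ?A"
      using \<open>J > 0\<close> by (simp add: mult.assoc[symmetric] ennreal_mult[symmetric])
    finally show "ennreal (w / J) * emeasure lborel Q \<le> emeasure lborel ?A" .
  qed
qed

end

section \<open>Null sets and radial kernels\<close>

lemma negligible_if_AE_notin: "AE x in lebesgue. x \<notin> S \<Longrightarrow> negligible S"
  by (auto simp: eventually_ae_filter negligible_iff_null_sets intro: null_sets_completion_subset)

lemma AE_lebesgue_translate:
  fixes c :: "'a::euclidean_space"
  assumes "AE x in lebesgue. P x"
  shows "AE x in lebesgue. P (x + c)"
proof -
  have "negligible {x. \<not> P x}"
    by (rule negligible_if_AE_notin) (use assms in simp)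
  then have "negligible ((+) (- c) ` {x. \<not> P x})"
    by (rule negligible_translation)
  moreover have "{x. \<not> P (x + c)} \<subseteq> (+) (- c) ` {x. \<not> P x}"
    by (auto intro!: image_eqI[where x = "_ + c"])
  ultimately have "negligible {x. \<not> P (x + c)}"
    using negligible_subset by blast
  then show ?thesis
    by (auto simp: eventually_ae_filter negligible_iff_null_sets)
qed

lemma not_AE_notin_open:
  assumes "open W" "W \<noteq> {}" "AE x in lebesgue. x \<notin> W"
  shows False
  using assms negligible_if_AE_notin open_not_negligible by blast

text \<open>The reflection that swaps two vectors of equal norm preserves \<open>N\<close> and null sets. Hence every
  nonzero point has a neighbourhood whose intersection with \<open>N\<close> is the image of a part of \<open>N \<inter> U\<close>.\<close>

lemma negligible_radial_if_negligible_cone: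
  fixes N U :: "'a::euclidean_space set"
  assumes radial: "\<And>x y. norm x = norm y \<Longrightarrow> x \<in> N \<Longrightarrow> y \<in> N"
    and "open U" "k \<in> U" "k \<noteq> 0" and cone: "\<And>t x. t > 0 \<Longrightarrow> x \<in> U \<Longrightarrow> t *\<^sub>R x \<in> U"
    and neg: "negligible (N \<inter> U)"
  shows "negligible N"
proof -
  have "negligible (N - {0})"
  proof (rule locally_negligible_alt[THEN iffD2], rule ballI)
    fix y assume y: "y \<in> N - {0}"
    define k' where "k' = (norm y / norm k) *\<^sub>R k"
    have k': "k' \<in> U" "norm k' = norm y"
      using cone[of "norm y / norm k" k] y assms(3,4) by (auto simp: k'_def)
    \<comment> \<open>\<open>T\<close> is the reflection that swaps \<open>y\<close> and \<open>k'\<close>; it is the identity if they coincide.\<close>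
    define w where "w = k' - y"
    define T where "T x = x - (2 * (x \<bullet> w) / (w \<bullet> w)) *\<^sub>R w" for x
    have ky: "y \<bullet> w = - (w \<bullet> w) / 2"
      using k'(2) by (simp add: w_def norm_eq inner_simps inner_commute algebra_simps)
    have Ty: "T y = k'"
    proof (cases "w = 0")
      case False
      then show ?thesis by (simp add: T_def ky) (simp add: w_def)
    qed (simp add: T_def, simp add: w_def)
    have TT: "T (T x) = x" for x
    proof (cases "w = 0")
      case False
      have "(T x \<bullet> w) = - (x \<bullet> w)"
        using False by (simp add: T_def inner_diff_left)
      then have "T (T x) = T x + (2 * (x \<bullet> w) / (w \<bullet> w)) *\<^sub>R w" 
        unfolding T_def[of "T x"] by simp
      then show ?thesis by (simp add: T_def)
    qed (simp add: T_def)
    have nT: "norm (T x) = norm x" for x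
    proof (cases "w = 0")
      case False
      define t where "t = 2 * (x \<bullet> w) / (w \<bullet> w)"
      have "t * (w \<bullet> w) = 2 * (x \<bullet> w)" using False by (simp add: t_def)
      moreover have "T x = x - t *\<^sub>R w" by (simp add: T_def t_def)
      ultimately have "T x \<bullet> T x = x \<bullet> x"
        by (simp add: inner_diff_left inner_diff_right inner_commute[of w x])
      then show ?thesis by (simp add: norm_eq)
    qed (simp add: T_def)
    have "linear T" unfolding T_def
      by (rule linearI) (auto simp: inner_simps algebra_simps add_divide_distrib)
    then have contT: "continuous_on UNIV T" and diffT: "T differentiable_on S" for S
      by (simp_all add: linear_continuous_on linear_conv_bounded_linear linear_imp_differentiable_on)
    let ?V = "(N - {0}) \<inter> T -` U"
    show "\<exists>V. openin (top_of_set (N - {0})) V \<and> y \<in> V \<and> negligible V"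
    proof (intro exI conjI)
      show "openin (top_of_set (N - {0})) ?V"
        using open_vimage[OF \<open>open U\<close> contT] by (auto simp: openin_open)
      show "y \<in> ?V" using y Ty k' by simp
      have "?V \<subseteq> T ` (N \<inter> U)"
      proof
        fix x assume x: "x \<in> ?V"
        then have "T x \<in> N \<inter> U" using radial[of x "T x"] nT by auto
        then show "x \<in> T ` (N \<inter> U)" using TT[of x] by (metis imageI)
      qed
      moreover have "negligible (T ` (N \<inter> U))"
        by (rule negligible_differentiable_image_negligible[OF order_refl neg diffT])
      ultimately show "negligible ?V" using negligible_subset by blast
    qed
  qed
  then have "negligible (insert 0 (N - {0}))"
    by (simp only: negligible_insert)
  then show ?thesis
    by (rule negligible_subset) auto
qed

text \<open>A radial function that vanishes almost everywhere on an open cone vanishes almost everywhere. The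
  radius \<open>M\<close> keeps the rescaled shifts \<open>\<epsilon> *\<^sub>R z\<close> small.\<close>

lemma nn_integral_radial_kernel_cone_pos:
  fixes \<rho> :: "'a::euclidean_space \<Rightarrow> real"
  assumes \<rho>: "radial_kernel \<rho>"
    and U: "open U" "k \<in> U" "k \<noteq> 0" and cone: "\<And>t x. t > 0 \<Longrightarrow> x \<in> U \<Longrightarrow> t *\<^sub>R x \<in> U"
  obtains M where "M > 0" "0 < (\<integral>\<^sup>+z. ennreal (\<rho> z) * indicator (U \<inter> ball 0 M) z \<partial>lebesgue)"
proof (rule ccontr)
  assume "\<not> thesis"
  with that have *: "(\<integral>\<^sup>+z. ennreal (\<rho> z) * indicator (U \<inter> ball 0 M) z \<partial>lebesgue) = 0" if "M > 0" for M
    using \<open>M > 0\<close> by (meson not_gr_zero)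
  have int: "integrable lebesgue \<rho>" and one: "integral\<^sup>L lebesgue \<rho> = 1" and nonneg: "\<And>z. 0 \<le> \<rho> z"
    and radial: "radial \<rho>" using \<rho> by (auto simp: radial_kernel_def)
  then have [measurable]: "\<rho> \<in> borel_measurable lebesgue" by auto
  define N where "N = {z. \<rho> z \<noteq> 0}"
  have "negligible (N \<inter> U \<inter> ball 0 (real (Suc i)))" for i
  proof -
    have "U \<inter> ball 0 (real (Suc i)) \<in> sets lebesgue" using U(1) by (simp add: borel_open open_Int sets_completionI_sets)
    then have [measurable]: "indicator (U \<inter> ball 0 (real (Suc i))) \<in> borel_measurable lebesgue" by simp
    have "(\<integral>\<^sup>+z. ennreal (\<rho> z) * indicator (U \<inter> ball 0 (real (Suc i))) z \<partial>lebesgue) = 0"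
      by (rule *) simp
    then have "AE z in lebesgue. ennreal (\<rho> z) * indicator (U \<inter> ball 0 (real (Suc i))) z = 0"
      by (rule nn_integral_0_iff_AE[THEN iffD1, rotated]) measurable
    then have "AE z in lebesgue. \<not> (z \<in> N \<inter> U \<inter> ball 0 (real (Suc i)))"
    proof eventually_elim
      case (elim z)
      then show ?case using nonneg[of z] by (auto simp: N_def indicator_def split: if_splits)
    qed
    then show ?thesis by (rule negligible_if_AE_notin)
  qed
  then have "negligible (\<Union>i. N \<inter> U \<inter> ball 0 (real (Suc i)))" by (rule negligible_Union_nat)
  moreover have "N \<inter> U \<subseteq> (\<Union>i. N \<inter> U \<inter> ball 0 (real (Suc i)))"
  proof
    fix z assume "z \<in> N \<inter> U"
    moreover obtain i where "norm z < real i" using reals_Archimedean2 by blast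
    ultimately have "z \<in> N \<inter> U \<inter> ball 0 (real (Suc i))" by simp
    then show "z \<in> (\<Union>i. N \<inter> U \<inter> ball 0 (real (Suc i)))" by (rule UN_I[OF UNIV_I])
  qed
  ultimately have neg: "negligible (N \<inter> U)" using negligible_subset by blast
  have "negligible N"
  proof (rule negligible_radial_if_negligible_cone[OF _ U cone neg])
    show "y \<in> N" if "norm x = norm y" "x \<in> N" for x y
      using radial that unfolding N_def radial_def by (metis (mono_tags) mem_Collect_eq)
  qed
  then have "AE z in lebesgue. z \<notin> N"
    by (simp add: negligible_iff_null_sets AE_not_in)
  then have "AE z in lebesgue. \<rho> z = 0" by (simp add: N_def)
  then have "integral\<^sup>L lebesgue \<rho> = 0" by (rule integral_eq_zero_AE)
  with one show False by simp
qed

lemma nn_integral_lebesgue_rescale: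
  fixes h :: "'a::euclidean_space \<Rightarrow> ennreal"
  assumes [measurable]: "h \<in> borel_measurable lebesgue" and "\<epsilon> > 0"
  shows "(\<integral>\<^sup>+z. ennreal (1 / \<epsilon> ^ DIM('a)) * h (z /\<^sub>R \<epsilon>) \<partial>lebesgue) = (\<integral>\<^sup>+z. h z \<partial>lebesgue)"
proof -
  have T: "(\<lambda>x::'a. 0 + (\<Sum>j\<in>Basis. (inverse \<epsilon> * (x \<bullet> j)) *\<^sub>R j)) = (\<lambda>x. x /\<^sub>R \<epsilon>)"
    by (auto simp: scaleR_sum_right[symmetric] scaleR_scaleR[symmetric] euclidean_representation simp del: scaleR_scaleR)
  have m: "(\<lambda>x::'a. x /\<^sub>R \<epsilon>) \<in> lebesgue \<rightarrow>\<^sub>M lebesgue" by (rule lebesgue_measurable_scaling)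
  have "(\<integral>\<^sup>+z. h z \<partial>lebesgue)
      = (\<integral>\<^sup>+z. h z \<partial>density (distr lebesgue lebesgue (\<lambda>x. x /\<^sub>R \<epsilon>)) (\<lambda>_. (\<Prod>j\<in>(Basis::'a set). \<bar>inverse \<epsilon>\<bar>)))"
    using lebesgue_affine_euclidean[of "\<lambda>_. inverse \<epsilon>" "0::'a", unfolded T] assms(2) by simp
  also have "\<dots> = (\<integral>\<^sup>+z. ennreal (1 / \<epsilon> ^ DIM('a)) * h z \<partial>distr lebesgue lebesgue (\<lambda>x. x /\<^sub>R \<epsilon>))"
    using assms(2) by (subst nn_integral_density) (auto simp: field_simps power_one_over)
  also have "\<dots> = (\<integral>\<^sup>+z. ennreal (1 / \<epsilon> ^ DIM('a)) * h (z /\<^sub>R \<epsilon>) \<partial>lebesgue)"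
    by (rule nn_integral_distr[OF m]) measurable
  finally show ?thesis by simp
qed

section \<open>Mixed differences and mixed derivatives\<close>

lemma dir_deriv_eq_0_outside:
  assumes "closed S" "\<And>x. x \<notin> S \<Longrightarrow> g x = 0" "x \<notin> S"
  shows "dir_deriv v g x = 0"
proof -
  have "(g has_derivative (\<lambda>_. 0)) (at x)"
    by (rule has_derivative_transform_within_open[of "\<lambda>_. 0" _ _ _ "- S"])
       (use assms in \<open>auto simp: open_Compl\<close>)
  then show ?thesis by (rule dir_deriv_eqI)
qed

lemma bounded_if_supported_cball:
  fixes g :: "'a::euclidean_space \<Rightarrow> real"
  assumes "continuous_on UNIV g" "\<And>x. x \<notin> cball a r \<Longrightarrow> g x = 0"
  shows "\<exists>B. \<forall>x. \<bar>g x\<bar> \<le> B"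
proof -
  have "compact (g ` cball a r)"
    using assms(1) by (intro compact_continuous_image) (auto intro: continuous_on_subset)
  then have "bounded (g ` cball a r)" by (rule compact_imp_bounded)
  then obtain B where B: "\<And>x. x \<in> cball a r \<Longrightarrow> \<bar>g x\<bar> \<le> B"
    unfolding bounded_iff by force
  have "\<bar>g x\<bar> \<le> max 0 B" for x
    using B[of x] assms(2)[of x] by (cases "x \<in> cball a r") (auto simp: max_def)
  then show ?thesis by blast
qed

text \<open>Differentiation under the integral sign, by dominated convergence: \<open>U\<close> is only integrable, and the
  translated factor carries the derivative.\<close>

lemma has_derivative_integral_translate:
  fixes U :: "'a::euclidean_space \<Rightarrow> real"
  assumes U: "integrable lborel U" and psi: "\<And>k. Ck k \<psi>"
    and bounded: "\<And>x. \<bar>\<psi> x\<bar> \<le> B0" "\<And>x. \<bar>dir_deriv v \<psi> x\<bar> \<le> B"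
  shows "((\<lambda>\<sigma>. LINT x|lborel. U x * \<psi> (x - (c + \<sigma> *\<^sub>R v))) has_real_derivative
     - (LINT x|lborel. U x * dir_deriv v \<psi> (x - (c + \<sigma> *\<^sub>R v)))) (at \<sigma>)"
proof -
  have [measurable]: "U \<in> borel_measurable borel" using U by (simp add: borel_measurable_integrable)
  have cont: "continuous_on UNIV \<psi>" "continuous_on UNIV (dir_deriv v \<psi>)"
    using psi[of 0] psi[of 1] by auto
  then have [measurable]: "\<psi> \<in> borel_measurable borel" "dir_deriv v \<psi> \<in> borel_measurable borel"
    by (auto intro: borel_measurable_continuous_onI)
  have D: "((\<lambda>\<sigma>. \<psi> (x - (c + \<sigma> *\<^sub>R v))) has_real_derivative - dir_deriv v \<psi> (x - (c + \<sigma> *\<^sub>R v))) (at \<sigma>)" for x \<sigma>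
  proof -
    let ?y = "x - (c + \<sigma> *\<^sub>R v)"
    have d: "\<psi> differentiable (at ?y)" using psi[of 1] by simp
    then have "(\<psi> has_derivative frechet_derivative \<psi> (at ?y)) (at ?y)"
      by (simp add: frechet_derivative_works)
    moreover have "((\<lambda>\<sigma>. x - (c + \<sigma> *\<^sub>R v)) has_derivative (\<lambda>t. t *\<^sub>R (- v))) (at \<sigma>)"
      by (auto intro!: derivative_eq_intros)
    ultimately have "((\<lambda>\<sigma>. \<psi> (x - (c + \<sigma> *\<^sub>R v))) has_derivative
        (\<lambda>t. frechet_derivative \<psi> (at ?y) (t *\<^sub>R (- v)))) (at \<sigma>)"
      using has_derivative_compose by blast
    moreover have "frechet_derivative \<psi> (at ?y) (t *\<^sub>R (- v)) = - dir_deriv v \<psi> ?y * t" for t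
      using linear_frechet_derivative[OF d]
      by (simp only: linear_cmul linear_neg dir_deriv_def) simp
    ultimately show ?thesis by (simp only: has_field_derivative_def)
  qed
  have int: "integrable lborel (\<lambda>x. U x * \<psi> (x - (c + \<sigma> *\<^sub>R v)))" for \<sigma>
  proof (rule Bochner_Integration.integrable_bound[where f = "\<lambda>x. B0 * U x"])
    show "AE x in lborel. norm (U x * \<psi> (x - (c + \<sigma> *\<^sub>R v))) \<le> norm (B0 * U x)"
    proof (rule AE_I2)
      fix x
      have "\<bar>\<psi> (x - (c + \<sigma> *\<^sub>R v))\<bar> \<le> \<bar>B0\<bar>" using bounded(1)[of "x - (c + \<sigma> *\<^sub>R v)"] by simp
      then show "norm (U x * \<psi> (x - (c + \<sigma> *\<^sub>R v))) \<le> norm (B0 * U x)"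
        using mult_left_mono[of "\<bar>\<psi> (x - (c + \<sigma> *\<^sub>R v))\<bar>" "\<bar>B0\<bar>" "\<bar>U x\<bar>"]
        by (simp add: abs_mult mult.commute)
    qed
  qed (use U in auto)
  let ?q = "\<lambda>h x. (\<psi> (x - (c + (\<sigma> + h) *\<^sub>R v)) - \<psi> (x - (c + \<sigma> *\<^sub>R v))) / h"
  have lip: "\<bar>?q h x\<bar> \<le> B" if "h \<noteq> 0" for h x
  proof -
    have "norm (\<psi> (x - (c + (\<sigma> + h) *\<^sub>R v)) - \<psi> (x - (c + \<sigma> *\<^sub>R v))) \<le> B * norm (\<sigma> + h - \<sigma>)"
      by (rule field_differentiable_bound[where S = UNIV and f' = "\<lambda>\<sigma>. - dir_deriv v \<psi> (x - (c + \<sigma> *\<^sub>R v))"])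
         (use D bounded(2) in auto)
    with that show ?thesis by (simp add: field_simps)
  qed
  have "((\<lambda>h. ((LINT x|lborel. U x * \<psi> (x - (c + (\<sigma> + h) *\<^sub>R v))) - (LINT x|lborel. U x * \<psi> (x - (c + \<sigma> *\<^sub>R v)))) / h)
     \<longlongrightarrow> - (LINT x|lborel. U x * dir_deriv v \<psi> (x - (c + \<sigma> *\<^sub>R v)))) (at 0)"
    unfolding tendsto_at_iff_sequentially comp_def
  proof (intro allI impI)
    fix h :: "nat \<Rightarrow> real" assume h: "\<forall>i. h i \<in> UNIV - {0}" "h \<longlonglongrightarrow> 0"
    have "(\<lambda>i. LINT x|lborel. U x * ?q (h i) x) \<longlonglongrightarrow> (LINT x|lborel. U x * - dir_deriv v \<psi> (x - (c + \<sigma> *\<^sub>R v)))"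
    proof (rule integral_dominated_convergence[where w = "\<lambda>x. B * \<bar>U x\<bar>"])
      show "integrable lborel (\<lambda>x. B * \<bar>U x\<bar>)" using U by auto
      show "AE x in lborel. norm (U x * ?q (h i) x) \<le> B * \<bar>U x\<bar>" for i
      proof (rule AE_I2)
        fix x
        show "norm (U x * ?q (h i) x) \<le> B * \<bar>U x\<bar>"
          using mult_left_mono[OF lip[of "h i" x], of "\<bar>U x\<bar>"] h(1)
          by (simp add: abs_mult mult.commute)
      qed
      show "AE x in lborel. (\<lambda>i. U x * ?q (h i) x) \<longlonglongrightarrow> U x * - dir_deriv v \<psi> (x - (c + \<sigma> *\<^sub>R v))"
      proof (rule AE_I2)
        fix x
        have "(?q (h i) x) = (\<lambda>h. ?q h x) (h i)" for i by simp
        have "(\<lambda>i. ?q (h i) x) \<longlonglongrightarrow> - dir_deriv v \<psi> (x - (c + \<sigma> *\<^sub>R v))"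
          using D[of x \<sigma>, unfolded DERIV_def tendsto_at_iff_sequentially comp_def] h by blast
        then show "(\<lambda>i. U x * ?q (h i) x) \<longlonglongrightarrow> U x * - dir_deriv v \<psi> (x - (c + \<sigma> *\<^sub>R v))"
          by (intro tendsto_intros)
      qed
    qed measurable
    moreover have "(LINT x|lborel. U x * ?q (h i) x) =
      ((LINT x|lborel. U x * \<psi> (x - (c + (\<sigma> + h i) *\<^sub>R v))) - (LINT x|lborel. U x * \<psi> (x - (c + \<sigma> *\<^sub>R v)))) / h i" for i
    proof -
      have "(LINT x|lborel. U x * ?q (h i) x) =
          (LINT x|lborel. (U x * \<psi> (x - (c + (\<sigma> + h i) *\<^sub>R v)) - U x * \<psi> (x - (c + \<sigma> *\<^sub>R v))) / h i)"
        by (simp only: right_diff_distrib times_divide_eq_right)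
      also have "\<dots> = (LINT x|lborel. U x * \<psi> (x - (c + (\<sigma> + h i) *\<^sub>R v)) - U x * \<psi> (x - (c + \<sigma> *\<^sub>R v))) / h i"
        by (rule integral_divide_zero)
      finally show ?thesis
        by (simp only: Bochner_Integration.integral_diff[OF int int])
    qed
    ultimately show "(\<lambda>i. ((LINT x|lborel. U x * \<psi> (x - (c + (\<sigma> + h i) *\<^sub>R v))) - (LINT x|lborel. U x * \<psi> (x - (c + \<sigma> *\<^sub>R v)))) / h i)
      \<longlonglongrightarrow> - (LINT x|lborel. U x * dir_deriv v \<psi> (x - (c + \<sigma> *\<^sub>R v)))"
      by (simp only: mult_minus_right Bochner_Integration.integral_minus)
  qed
  then show ?thesis unfolding DERIV_def .
qed

text \<open>The mixed second difference of \<open>u\<close> in the directions \<open>e\<close> and \<open>f\<close> with step \<open>h\<close>.\<close>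

definition mixed_diff :: "'a::euclidean_space \<Rightarrow> 'a \<Rightarrow> real \<Rightarrow> ('a \<Rightarrow> real) \<Rightarrow> 'a \<Rightarrow> real" where
  "mixed_diff e f h u x = u (x + (h *\<^sub>R e + h *\<^sub>R f)) - u (x + h *\<^sub>R e) - u (x + h *\<^sub>R f) + u x"

text \<open>An orthogonal decomposition with a product domain, a unit vector in each summand, and a ball of
  radius \<open>2 * r\<close> about \<open>x0\<close> inside the domain. The factor \<open>2\<close> leaves room to translate the ball of radius
  \<open>r\<close> by vectors of norm at most \<open>r\<close>.\<close>

locale split_domain =
  fixes X1 X2 \<Omega>1 \<Omega>2 :: "'a::euclidean_space set" and e f x0 :: 'a and r :: real
  assumes sub: "subspace X1" "subspace X2"
    and sum_UNIV: "X1 + X2 = UNIV"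
    and orth: "\<And>x y. x \<in> X1 \<Longrightarrow> y \<in> X2 \<Longrightarrow> orthogonal x y"
    and dom_sub: "\<Omega>1 \<subseteq> X1" "\<Omega>2 \<subseteq> X2"
    and dom_bounded: "bounded \<Omega>1" "bounded \<Omega>2"
    and dom_open: "open (\<Omega>1 + \<Omega>2)"
    and e: "e \<in> X1" "norm e = 1" and f: "f \<in> X2" "norm f = 1"
    and r: "r > 0" and cball_sub: "cball x0 (2 * r) \<subseteq> \<Omega>1 + \<Omega>2"
begin

lemma component_add:
  assumes "a \<in> X1" "b \<in> X2"
  shows "component X1 X2 (a + b) = a" "component X2 X1 (a + b) = b"
proof -
  show "component X1 X2 (a + b) = a" by (rule component_eqI) (use sub orth assms in auto)
  have "component X2 X1 (b + a) = b" by (rule component_eqI) (use sub orth assms orthogonal_commute in blast)+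
  then show "component X2 X1 (a + b) = b" by (simp add: add.commute)
qed

lemma split:
  obtains a b where "a \<in> X1" "b \<in> X2" "x = a + b"
proof -
  have "x \<in> X1 + X2" by (simp add: sum_UNIV)
  then show ?thesis using that by (auto elim: set_plus_elim)
qed

lemma ef: "e \<bullet> f = 0" "f \<bullet> e = 0" "e \<bullet> e = 1" "f \<bullet> f = 1"
  using orth[of e f] e f by (auto simp: orthogonal_def inner_commute norm_eq_1)

lemma component_inner:
  "component X1 X2 z \<bullet> e = z \<bullet> e" "component X1 X2 z \<bullet> f = 0"
  "component X2 X1 z \<bullet> e = 0" "component X2 X1 z \<bullet> f = z \<bullet> f"
proof -
  obtain a b where ab: "a \<in> X1" "b \<in> X2" "z = a + b" by (rule split)
  have "a \<bullet> f = 0" "b \<bullet> e = 0"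
    using orth[of a f] orth[of e b] ab e f by (auto simp: orthogonal_def inner_commute)
  then show "component X1 X2 z \<bullet> e = z \<bullet> e" "component X1 X2 z \<bullet> f = 0"
  "component X2 X1 z \<bullet> e = 0" "component X2 X1 z \<bullet> f = z \<bullet> f"
    using component_add ab by (auto simp: inner_add_left)
qed

lemma norm_shift_le:
  assumes "0 \<le> \<sigma>" "\<sigma> \<le> r / 2" "0 \<le> \<tau>" "\<tau> \<le> r / 2"
  shows "norm (\<sigma> *\<^sub>R e + \<tau> *\<^sub>R f) \<le> r"
  using norm_triangle_ineq[of "\<sigma> *\<^sub>R e" "\<tau> *\<^sub>R f"] assms e f by simp

lemma cball_shift:
  assumes "x \<in> cball x0 r" "norm w \<le> r"
  shows "x + w \<in> cball x0 (2 * r)"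
  using norm_triangle_ineq[of "x - x0" w] assms by (simp add: dist_norm norm_minus_commute algebra_simps)

text \<open>A function of one component only has vanishing mixed differences, almost everywhere because the
  exceptional null set may be translated.\<close>

lemma not_in_S_space:
  assumes W: "open W" "W \<noteq> {}" "W \<subseteq> ball x0 r" and h: "0 < h" "h \<le> r / 2"
    and diff: "\<And>x. x \<in> W \<Longrightarrow> mixed_diff e f h u x \<noteq> 0"
  shows "u \<notin> S_space X1 X2 \<Omega>1 \<Omega>2"
proof
  assume "u \<in> S_space X1 X2 \<Omega>1 \<Omega>2"
  then obtain g where "(AE x in lebesgue_on (\<Omega>1 + \<Omega>2). u x = g (component X1 X2 x)) \<or>
      (AE x in lebesgue_on (\<Omega>1 + \<Omega>2). u x = g (component X2 X1 x))"
    unfolding S_space_def by blast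
  then obtain P where P: "P = component X1 X2 \<or> P = component X2 X1"
      and ae: "AE x in lebesgue_on (\<Omega>1 + \<Omega>2). u x = g (P x)"
    by blast
  have "AE x in lebesgue. x \<in> \<Omega>1 + \<Omega>2 \<longrightarrow> u x = g (P x)"
    using ae dom_open by (subst (asm) AE_restrict_space_iff) auto
  then have ae: "AE x in lebesgue. x + c \<in> \<Omega>1 + \<Omega>2 \<longrightarrow> u (x + c) = g (P (x + c))" for c
    by (rule AE_lebesgue_translate)
  have "AE x in lebesgue. x \<notin> W"
    using ae[of 0] ae[of "h *\<^sub>R e"] ae[of "h *\<^sub>R f"] ae[of "h *\<^sub>R e + h *\<^sub>R f"]
  proof eventually_elim
    case (elim x)
    show "x \<notin> W"
    proof
      assume "x \<in> W"
      then have x: "x \<in> cball x0 r" using W by auto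
      have in_dom: "x + w \<in> \<Omega>1 + \<Omega>2" if "norm w \<le> r" for w
        using cball_shift[OF x that] cball_sub by blast
      obtain a b where ab: "a \<in> X1" "b \<in> X2" "x = a + b" by (rule split)
      have he: "a + h *\<^sub>R e \<in> X1" "b + h *\<^sub>R f \<in> X2"
        using ab sub e f by (auto intro!: subspace_add subspace_scale)
      have shifts: "x + h *\<^sub>R e = (a + h *\<^sub>R e) + b" "x + h *\<^sub>R f = a + (b + h *\<^sub>R f)"
        "x + (h *\<^sub>R e + h *\<^sub>R f) = (a + h *\<^sub>R e) + (b + h *\<^sub>R f)"
        using ab by auto
      have cx: "component X1 X2 x = a" "component X2 X1 x = b"
        using component_add[OF ab(1,2)] ab(3) by simp_all
      have comp:
        "component X1 X2 (x + (h *\<^sub>R e + h *\<^sub>R f)) = component X1 X2 (x + h *\<^sub>R e)"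
        "component X1 X2 (x + h *\<^sub>R f) = component X1 X2 x"
        "component X2 X1 (x + (h *\<^sub>R e + h *\<^sub>R f)) = component X2 X1 (x + h *\<^sub>R f)"
        "component X2 X1 (x + h *\<^sub>R e) = component X2 X1 x"
        by (simp_all only: shifts cx component_add[OF he(1) ab(2)] component_add[OF ab(1) he(2)]
          component_add[OF he])
      have "mixed_diff e f h u x = 0"
        using elim in_dom[of 0] in_dom[of "h *\<^sub>R e"] in_dom[of "h *\<^sub>R f"] in_dom[of "h *\<^sub>R e + h *\<^sub>R f"]
          norm_shift_le[of h h] h r e f P comp unfolding mixed_diff_def by auto
      with diff \<open>x \<in> W\<close> show False by blast
    qed
  qed
  with W show False using not_AE_notin_open by blast
qed

text \<open>If the mixed derivative vanished, then the pairings \<open>F \<sigma> \<tau>\<close> of \<open>u\<close> with a bump function translated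
  by \<open>\<sigma> *\<^sub>R e + \<tau> *\<^sub>R f\<close> would satisfy \<open>\<partial>\<^sub>\<sigma>\<partial>\<^sub>\<tau> F = 0\<close>, so the mixed difference of \<open>F\<close> would be \<open>0\<close>. By
  translation invariance that difference is the pairing of the bump with the mixed difference of \<open>u\<close>,
  which is positive.\<close>

lemma mu_nonzero_if_mixed_diff_nonneg:
  assumes u[measurable]: "u \<in> borel_measurable borel"
    and bound: "\<And>x. x \<in> cball x0 (2 * r) \<Longrightarrow> \<bar>u x\<bar> \<le> M"
    and W: "open W" "W \<noteq> {}" "W \<subseteq> ball x0 r" and h: "0 < h" "h \<le> r / 2"
    and nonneg: "\<And>x. 0 \<le> mixed_diff e f h u x"
    and pos: "\<And>x. x \<in> W \<Longrightarrow> 0 < mixed_diff e f h u x"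
  shows "mu_nonzero X1 X2 (\<Omega>1 + \<Omega>2) u"
proof (rule ccontr)
  assume "\<not> mu_nonzero X1 X2 (\<Omega>1 + \<Omega>2) u"
  then have mu0: "mu (\<Omega>1 + \<Omega>2) u e f \<phi> = 0" if "test_function (\<Omega>1 + \<Omega>2) \<phi>" for \<phi>
    using that e f unfolding mu_nonzero_def by blast
  \<comment> \<open>Only the values of \<open>u\<close> near \<open>x0\<close> enter; cutting off makes \<open>u\<close> integrable.\<close>
  define U where "U x = indicator (cball x0 (2 * r)) x * u x" for x
  have [measurable]: "U \<in> borel_measurable borel"
    unfolding U_def[abs_def] using u by (intro borel_measurable_times borel_measurable_indicator) auto
  have U_int: "integrable lborel U"
  proof (rule Bochner_Integration.integrable_bound[where f = "\<lambda>x. M * indicator (cball x0 (2 * r)) x"])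
    show "integrable lborel (\<lambda>x. M * indicator (cball x0 (2 * r)) x)"
      using emeasure_lborel_cball_finite[of x0 "2 * r"] by simp
    show "AE x in lborel. norm (U x) \<le> norm (M * indicator (cball x0 (2 * r)) x)"
    proof (rule AE_I2)
      fix x
      show "norm (U x) \<le> norm (M * indicator (cball x0 (2 * r)) x)"
        using bound[of x] by (cases "x \<in> cball x0 (2 * r)") (auto simp: U_def)
    qed
  qed simp
  define b where "b = bump x0 r"
  define b1 where "b1 = dir_deriv e b"
  define b2 where "b2 = dir_deriv f b1"
  have Cb: "Ck k b" "Ck k b1" "Ck k b2" for k
  proof -
    have "Ck k b" for k unfolding b_def by (rule Ck_bump)
    moreover from this[of "Suc _"] have "Ck k b1" for k unfolding b1_def by simp
    moreover from this[of "Suc _"] have "Ck k b2" for k unfolding b2_def by simp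
    ultimately show "Ck k b" "Ck k b1" "Ck k b2" by auto
  qed
  have b0: "b x = 0" if "x \<notin> cball x0 r" for x
    using that bump_pos_iff[OF r, of x0 x] bump_nonneg[of x0 r x] by (auto simp: b_def)
  have b10: "b1 x = 0" if "x \<notin> cball x0 r" for x
    unfolding b1_def by (rule dir_deriv_eq_0_outside[OF closed_cball b0 that])
  have b20: "b2 x = 0" if "x \<notin> cball x0 r" for x
    unfolding b2_def by (rule dir_deriv_eq_0_outside[OF closed_cball b10 that])
  have cont: "continuous_on UNIV b" "continuous_on UNIV b1" "continuous_on UNIV b2"
    using Cb[of 0] by auto
  have [measurable]: "b \<in> borel_measurable borel" "b1 \<in> borel_measurable borel" "b2 \<in> borel_measurable borel"
    using cont by (auto intro: borel_measurable_continuous_onI)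
  obtain B0 B1 B2 where B: "\<And>x. \<bar>b x\<bar> \<le> B0" "\<And>x. \<bar>b1 x\<bar> \<le> B1" "\<And>x. \<bar>b2 x\<bar> \<le> B2"
    using bounded_if_supported_cball[OF cont(1) b0] bounded_if_supported_cball[OF cont(2) b10]
      bounded_if_supported_cball[OF cont(3) b20] by metis
  define F where "F \<sigma> \<tau> = (LINT x|lborel. U x * b (x - (\<sigma> *\<^sub>R e + \<tau> *\<^sub>R f)))" for \<sigma> \<tau>
  define F1 where "F1 \<sigma> \<tau> = (LINT x|lborel. U x * b1 (x - (\<sigma> *\<^sub>R e + \<tau> *\<^sub>R f)))" for \<sigma> \<tau>
  define F2 where "F2 \<sigma> \<tau> = (LINT x|lborel. U x * b2 (x - (\<sigma> *\<^sub>R e + \<tau> *\<^sub>R f)))" for \<sigma> \<tau>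
  have DF: "((\<lambda>\<sigma>. F \<sigma> \<tau>) has_real_derivative - F1 \<sigma> \<tau>) (at \<sigma>)" for \<sigma> \<tau>
    using has_derivative_integral_translate[OF U_int Cb(1), of B0 e B1 "\<tau> *\<^sub>R f" \<sigma>] B
    by (simp add: F_def F1_def b1_def[symmetric] add.commute)
  have DF1: "((\<lambda>\<tau>. F1 \<sigma> \<tau>) has_real_derivative - F2 \<sigma> \<tau>) (at \<tau>)" for \<sigma> \<tau>
    using has_derivative_integral_translate[OF U_int Cb(2), of B1 f B2 "\<sigma> *\<^sub>R e" \<tau>] B
    by (simp add: F1_def F2_def b2_def[symmetric])
  have F2: "F2 \<sigma> \<tau> = 0" if "0 \<le> \<sigma>" "\<sigma> \<le> h" "0 \<le> \<tau>" "\<tau> \<le> h" for \<sigma> \<tau>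
  proof -
    let ?w = "\<sigma> *\<^sub>R e + \<tau> *\<^sub>R f"
    have w: "norm ?w \<le> r" using that h by (intro norm_shift_le) auto
    have supp: "x \<in> cball x0 (2 * r)" if "x - ?w \<in> cball x0 r" for x
      using cball_shift[OF that w] by simp
    have "test_function (\<Omega>1 + \<Omega>2) (\<lambda>x. b (x - ?w))"
    proof (rule test_function_if_supported_cball[OF _ _ cball_sub])
      show "Ck k (\<lambda>x. b (x - ?w))" for k by (rule Ck_shift[OF Cb(1)])
      show "b (x - ?w) = 0" if "x \<notin> cball x0 (2 * r)" for x using that supp b0 by blast
    qed
    from mu0[OF this] have "regular_dist (\<Omega>1 + \<Omega>2) u (dir_deriv f (dir_deriv e (\<lambda>x. b (x - ?w)))) = 0"
      by (simp add: mu_def dist_deriv_def)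
    moreover have "dir_deriv e (\<lambda>x. b (x - ?w)) = (\<lambda>x. b1 (x - ?w))"
      unfolding b1_def using Cb(1)[of 1] by (intro dir_deriv_shift) simp
    moreover have "dir_deriv f (\<lambda>x. b1 (x - ?w)) = (\<lambda>x. b2 (x - ?w))"
      unfolding b2_def using Cb(2)[of 1] by (intro dir_deriv_shift) simp
    ultimately have "(LINT x:(\<Omega>1 + \<Omega>2)|lebesgue. u x * b2 (x - ?w)) = 0"
      by (simp add: regular_dist_def)
    also have "(LINT x:(\<Omega>1 + \<Omega>2)|lebesgue. u x * b2 (x - ?w)) = (LINT x|lebesgue. U x * b2 (x - ?w))"
      unfolding set_lebesgue_integral_def
    proof (rule Bochner_Integration.integral_cong)
      fix x
      show "indicat_real (\<Omega>1 + \<Omega>2) x *\<^sub>R (u x * b2 (x - ?w)) = U x * b2 (x - ?w)"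
        using supp[of x] b20[of "x - ?w"] cball_sub
        by (cases "x - ?w \<in> cball x0 r") (auto simp: U_def indicator_def)
    qed simp
    also have "\<dots> = F2 \<sigma> \<tau>"
      unfolding F2_def by (rule integral_completion) measurable
    finally show ?thesis .
  qed
  have F1: "F1 \<sigma> h = F1 \<sigma> 0" if "0 \<le> \<sigma>" "\<sigma> \<le> h" for \<sigma>
  proof (rule DERIV_isconst_end[where f = "F1 \<sigma>"])
    show "continuous_on {0..h} (F1 \<sigma>)"
      using DF1 by (intro continuous_at_imp_continuous_on) (auto intro: DERIV_isCont)
    show "(F1 \<sigma> has_real_derivative 0) (at x)" if "0 < x" "x < h" for x
      using DF1[of \<sigma> x] F2[of \<sigma> x] that \<open>0 \<le> \<sigma>\<close> \<open>\<sigma> \<le> h\<close> by simp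
  qed (use h in simp)
  have F: "F h h - F h 0 = F 0 h - F 0 0"
  proof (rule DERIV_isconst_end[where f = "\<lambda>\<sigma>. F \<sigma> h - F \<sigma> 0"])
    have D: "((\<lambda>\<sigma>. F \<sigma> h - F \<sigma> 0) has_real_derivative - F1 \<sigma> h - - F1 \<sigma> 0) (at \<sigma>)" for \<sigma>
      by (intro DERIV_diff DF)
    then show "continuous_on {0..h} (\<lambda>\<sigma>. F \<sigma> h - F \<sigma> 0)"
      by (intro continuous_at_imp_continuous_on) (blast intro: DERIV_isCont)
    show "((\<lambda>\<sigma>. F \<sigma> h - F \<sigma> 0) has_real_derivative 0) (at x)" if "0 < x" "x < h" for x
      using D[of x] F1[of x] that by simp
  qed (use h in simp)
  have tr: "F \<sigma> \<tau> = (LINT x|lborel. u (x + (\<sigma> *\<^sub>R e + \<tau> *\<^sub>R f)) * b x)"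
    and tr_int: "integrable lborel (\<lambda>x. u (x + (\<sigma> *\<^sub>R e + \<tau> *\<^sub>R f)) * b x)"
    if "0 \<le> \<sigma>" "\<sigma> \<le> h" "0 \<le> \<tau>" "\<tau> \<le> h" for \<sigma> \<tau>
  proof -
    let ?w = "\<sigma> *\<^sub>R e + \<tau> *\<^sub>R f"
    have w: "norm ?w \<le> r" using that h by (intro norm_shift_le) auto
    have eq: "U (x + ?w) * b x = u (x + ?w) * b x" for x
      using cball_shift[of x ?w] w b0[of x] by (cases "x \<in> cball x0 r") (auto simp: U_def)
    have "F \<sigma> \<tau> = (LINT x|distr lborel borel ((+) ?w). U x * b (x - ?w))"
      unfolding F_def by (simp add: lborel_distr_plus)
    also have "\<dots> = (LINT x|lborel. U (?w + x) * b (?w + x - ?w))"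
      by (rule integral_distr) measurable
    also have "\<dots> = (LINT x|lborel. u (x + ?w) * b x)"
      by (rule Bochner_Integration.integral_cong) (use eq in \<open>auto simp: add.commute\<close>)
    finally show "F \<sigma> \<tau> = (LINT x|lborel. u (x + ?w) * b x)" .
    have "integrable (distr lborel borel ((+) ?w)) U" using U_int by (simp add: lborel_distr_plus)
    then have i: "integrable lborel (\<lambda>x. U (x + ?w))" 
      by (subst (asm) integrable_distr_eq) (auto simp: add.commute)
    have "integrable lborel (\<lambda>x. U (x + ?w) * b x)"
    proof (rule Bochner_Integration.integrable_bound[where f = "\<lambda>x. B0 * U (x + ?w)"])
      show "integrable lborel (\<lambda>x. B0 * U (x + ?w))" using i by simp
      show "AE x in lborel. norm (U (x + ?w) * b x) \<le> norm (B0 * U (x + ?w))"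
      proof (rule AE_I2)
        fix x
        have "\<bar>b x\<bar> \<le> \<bar>B0\<bar>" using B(1)[of x] by simp
        then show "norm (U (x + ?w) * b x) \<le> norm (B0 * U (x + ?w))"
          using mult_left_mono[of "\<bar>b x\<bar>" "\<bar>B0\<bar>" "\<bar>U (x + ?w)\<bar>"]
          by (simp add: abs_mult mult.commute)
      qed
    qed measurable
    then show "integrable lborel (\<lambda>x. u (x + ?w) * b x)" by (simp add: eq)
  qed
  have md: "mixed_diff e f h u x * b x = u (x + (h *\<^sub>R e + h *\<^sub>R f)) * b x - u (x + (h *\<^sub>R e + 0 *\<^sub>R f)) * b x
      - u (x + (0 *\<^sub>R e + h *\<^sub>R f)) * b x + u (x + (0 *\<^sub>R e + 0 *\<^sub>R f)) * b x" for x
    by (simp add: mixed_diff_def algebra_simps)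
  have 0: "0 \<le> h" using h by simp
  note F_eq = tr[OF 0 order_refl 0 order_refl] tr[OF 0 order_refl order_refl 0]
    tr[OF order_refl 0 0 order_refl] tr[OF order_refl 0 order_refl 0]
  note F_int = tr_int[OF 0 order_refl 0 order_refl] tr_int[OF 0 order_refl order_refl 0]
    tr_int[OF order_refl 0 0 order_refl] tr_int[OF order_refl 0 order_refl 0]
  have int: "integrable lborel (\<lambda>x. mixed_diff e f h u x * b x)"
    unfolding md by (intro Bochner_Integration.integrable_diff Bochner_Integration.integrable_add F_int)
  have "(LINT x|lborel. mixed_diff e f h u x * b x) = F h h - F h 0 - F 0 h + F 0 0"
    unfolding md F_eq
    by (simp only: F_int Bochner_Integration.integral_diff Bochner_Integration.integral_add
        Bochner_Integration.integrable_diff)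
  then have "(LINT x|lborel. mixed_diff e f h u x * b x) = 0" using F by simp
  moreover have "AE x in lborel. 0 \<le> mixed_diff e f h u x * b x"
    by (rule AE_I2) (use nonneg in \<open>simp add: b_def bump_nonneg\<close>)
  ultimately have "AE x in lborel. mixed_diff e f h u x * b x = 0"
    using integral_nonneg_eq_0_iff_AE[OF int] by blast
  then have "AE x in lebesgue. mixed_diff e f h u x * b x = 0"
    by (rule AE_completion)
  then have "AE x in lebesgue. x \<notin> W"
  proof eventually_elim
    case (elim x)
    then show ?case using pos[of x] bump_pos_iff[OF r, of x0 x] W(3) by (auto simp: b_def)
  qed
  with W show False using not_AE_notin_open by blast
qed

end

section \<open>Two-sided bounds for the energy\<close>

text \<open>The numerator of the energy density: the product of the powers of the two partial increments of
  \<open>u\<close> at \<open>x\<close> belonging to the shift \<open>z\<close>.\<close>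

definition double_increment ::
    "'a::euclidean_space set \<Rightarrow> 'a set \<Rightarrow> real \<Rightarrow> real \<Rightarrow> ('a \<Rightarrow> real) \<Rightarrow> 'a \<Rightarrow> 'a \<Rightarrow> real" where
  "double_increment X1 X2 \<theta>1 \<theta>2 u z x =
     \<bar>u (x + component X1 X2 z) - u x\<bar> powr \<theta>1 * \<bar>u (x + component X2 X1 z) - u x\<bar> powr \<theta>2"

context split_domain
begin

lemma shrink_subset:
  assumes "0 < \<epsilon>"
  shows "shrink X1 \<Omega>1 \<epsilon> + shrink X2 \<Omega>2 \<epsilon> \<subseteq> \<Omega>1 + \<Omega>2"
proof (rule set_plus_mono2)
  show "shrink X1 \<Omega>1 \<epsilon> \<subseteq> \<Omega>1" "shrink X2 \<Omega>2 \<epsilon> \<subseteq> \<Omega>2"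
    using assms subspace_0[OF sub(1)] subspace_0[OF sub(2)] by (force simp: shrink_def)+
qed

lemma ball_subset_shrink:
  assumes "0 < \<epsilon>" "\<epsilon> \<le> r"
  shows "ball x0 r \<subseteq> shrink X1 \<Omega>1 \<epsilon> + shrink X2 \<Omega>2 \<epsilon>"
proof
  fix x assume x: "x \<in> ball x0 r"
  obtain a b where ab: "a \<in> X1" "b \<in> X2" "x = a + b" by (rule split)
  have in_dom: "x + z \<in> \<Omega>1 + \<Omega>2" if "norm z < \<epsilon>" for z
    using cball_shift[of x z] x that assms cball_sub by auto
  have dom: "a' \<in> \<Omega>1 \<and> b' \<in> \<Omega>2" if "a' \<in> X1" "b' \<in> X2" "a' + b' \<in> \<Omega>1 + \<Omega>2" for a' b'
  proof -
    from that(3) obtain c d where cd: "c \<in> \<Omega>1" "d \<in> \<Omega>2" "a' + b' = c + d"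
      by (auto elim: set_plus_elim)
    then have "c \<in> X1" "d \<in> X2" using dom_sub by auto
    with cd show ?thesis using component_add[of c d] component_add[OF that(1,2)] by simp
  qed
  have "a \<in> shrink X1 \<Omega>1 \<epsilon>"
    unfolding shrink_def
  proof (intro INT_I)
    fix z assume "z \<in> {z \<in> X1. norm z < \<epsilon>}"
    then have "a + z \<in> \<Omega>1"
      using in_dom[of z] dom[of "a + z" b] ab sub by (auto simp: subspace_add add_ac)
    then show "a \<in> (\<lambda>x. x - z) ` \<Omega>1" by (auto intro!: image_eqI[where x = "a + z"])
  qed
  moreover have "b \<in> shrink X2 \<Omega>2 \<epsilon>"
    unfolding shrink_def
  proof (intro INT_I)
    fix z assume "z \<in> {z \<in> X2. norm z < \<epsilon>}"
    then have "b + z \<in> \<Omega>2"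
      using in_dom[of z] dom[of a "b + z"] ab sub by (auto simp: subspace_add add_ac)
    then show "b \<in> (\<lambda>x. x - z) ` \<Omega>2" by (auto intro!: image_eqI[where x = "b + z"])
  qed
  ultimately show "x \<in> shrink X1 \<Omega>1 \<epsilon> + shrink X2 \<Omega>2 \<epsilon>" using ab by (auto intro: set_plus_intro)
qed

text \<open>The shifts for which the energy is bounded below: both coordinates along \<open>e\<close> and \<open>f\<close> are negative
  and comparable to the norm. The cone is not empty because \<open>1/2 < 1 / sqrt 2\<close>.\<close>

definition neg_cone :: "'a set" where
  "neg_cone = {z. z \<bullet> e < - norm z / 2 \<and> z \<bullet> f < - norm z / 2}"

lemma neg_cone_props:
  shows "open neg_cone" "- (e + f) \<in> neg_cone" "- (e + f) \<noteq> 0"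
    and "\<And>t z. t > 0 \<Longrightarrow> z \<in> neg_cone \<Longrightarrow> t *\<^sub>R z \<in> neg_cone"
proof -
  show "open neg_cone" unfolding neg_cone_def
    by (intro open_Collect_conj open_Collect_less continuous_intros) auto
  have "(norm (- (e + f)))\<^sup>2 = 2"
    by (simp add: power2_norm_eq_inner inner_simps ef)
  then have "norm (- (e + f)) < 2" by (simp add: power2_less_imp_less[of _ 2])
  moreover have "(- (e + f)) \<bullet> e = - 1" "(- (e + f)) \<bullet> f = - 1"
    by (simp_all only: inner_minus_left inner_add_left ef)
  ultimately show "- (e + f) \<in> neg_cone" unfolding neg_cone_def mem_Collect_eq by linarith
  show "- (e + f) \<noteq> 0" using \<open>(norm (- (e + f)))\<^sup>2 = 2\<close> by (metis norm_zero zero_power2 zero_neq_numeral)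
  show "t *\<^sub>R z \<in> neg_cone" if "t > 0" "z \<in> neg_cone" for t z
    using that mult_strict_left_mono[of "z \<bullet> e" "- norm z / 2" t]
      mult_strict_left_mono[of "z \<bullet> f" "- norm z / 2" t] by (auto simp: neg_cone_def)
qed

lemma rescale_eq:
  fixes z :: 'a
  assumes "\<And>z. 0 \<le> \<rho> z" "0 < \<epsilon>"
  shows "ennreal (rescale \<rho> \<epsilon> z) = ennreal (1 / \<epsilon> ^ DIM('a)) * ennreal (\<rho> (z /\<^sub>R \<epsilon>))"
  using assms by (simp add: rescale_def ennreal_mult[symmetric])

lemma energy_le:
  assumes \<rho>: "radial_kernel \<rho>"
    and inner: "\<And>\<epsilon> z. 0 < \<epsilon> \<Longrightarrow> (\<integral>\<^sup>+x\<in>shrink X1 \<Omega>1 \<epsilon> + shrink X2 \<Omega>2 \<epsilon>.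
           ennreal (double_increment X1 X2 \<theta>1 \<theta>2 u z x / norm z powr p) \<partial>lebesgue) \<le> ennreal C"
  shows "energy X1 X2 \<Omega>1 \<Omega>2 \<rho> \<theta>1 \<theta>2 p u \<le> ennreal C"
proof -
  have int: "integrable lebesgue \<rho>" and one: "integral\<^sup>L lebesgue \<rho> = 1" and nonneg: "\<And>z. 0 \<le> \<rho> z"
    using \<rho> by (auto simp: radial_kernel_def)
  have [measurable]: "(\<lambda>z. ennreal (\<rho> z)) \<in> borel_measurable lebesgue" using int by auto
  have "energy_eps X1 X2 \<Omega>1 \<Omega>2 \<rho> \<theta>1 \<theta>2 p \<epsilon> u \<le> ennreal C" if "0 < \<epsilon>" for \<epsilon>
  proof -
    have "energy_eps X1 X2 \<Omega>1 \<Omega>2 \<rho> \<theta>1 \<theta>2 p \<epsilon> u \<le> (\<integral>\<^sup>+z. ennreal (rescale \<rho> \<epsilon> z) * ennreal C \<partial>lebesgue)"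
      unfolding energy_eps_def
      using inner[OF that] by (intro nn_integral_mono mult_left_mono) (auto simp: double_increment_def)
    also have "\<dots> = (\<integral>\<^sup>+z. ennreal (1 / \<epsilon> ^ DIM('a)) * (ennreal (\<rho> (z /\<^sub>R \<epsilon>)) * ennreal C) \<partial>lebesgue)"
      by (simp only: rescale_eq[OF nonneg that] mult.assoc)
    also have "\<dots> = (\<integral>\<^sup>+z. ennreal (\<rho> z) * ennreal C \<partial>lebesgue)"
      by (rule nn_integral_lebesgue_rescale[OF _ that]) measurable
    also have "\<dots> = (\<integral>\<^sup>+z. ennreal (\<rho> z) \<partial>lebesgue) * ennreal C"
      by (rule nn_integral_multc) measurable
    also have "(\<integral>\<^sup>+z. ennreal (\<rho> z) \<partial>lebesgue) = 1"
      using nn_integral_eq_integral[OF int] nonneg one by simp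
    finally show ?thesis by simp
  qed
  then have "\<forall>\<^sub>F \<epsilon> in at_right 0. energy_eps X1 X2 \<Omega>1 \<Omega>2 \<rho> \<theta>1 \<theta>2 p \<epsilon> u \<le> ennreal C"
    by (auto simp: eventually_at_filter)
  then have "energy X1 X2 \<Omega>1 \<Omega>2 \<rho> \<theta>1 \<theta>2 p u \<le> Liminf (at_right (0::real)) (\<lambda>_. ennreal C)"
    unfolding energy_def by (rule Liminf_mono)
  then show ?thesis by (simp add: Liminf_const trivial_limit_at_right_real)
qed

text \<open>The lower bound is only needed for shifts in the cone: by scaling, they carry the same positive
  share of the mass of the rescaled kernels for all small \<open>\<epsilon>\<close>.\<close>

lemma energy_pos:
  assumes \<rho>: "radial_kernel \<rho>" and C: "0 < C" "0 < \<eta>"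
    and inner: "\<And>\<epsilon> z. 0 < \<epsilon> \<Longrightarrow> \<epsilon> \<le> r \<Longrightarrow> z \<in> neg_cone \<Longrightarrow> norm z < \<eta> \<Longrightarrow>
      ennreal C \<le> (\<integral>\<^sup>+x\<in>shrink X1 \<Omega>1 \<epsilon> + shrink X2 \<Omega>2 \<epsilon>.
           ennreal (double_increment X1 X2 \<theta>1 \<theta>2 u z x / norm z powr p) \<partial>lebesgue)"
  shows "0 < energy X1 X2 \<Omega>1 \<Omega>2 \<rho> \<theta>1 \<theta>2 p u"
proof -
  obtain M where M: "M > 0" "0 < (\<integral>\<^sup>+z. ennreal (\<rho> z) * indicator (neg_cone \<inter> ball 0 M) z \<partial>lebesgue)"
    using nn_integral_radial_kernel_cone_pos[OF \<rho> neg_cone_props(1-3)] neg_cone_props(4) by blast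
  define \<kappa> where "\<kappa> = (\<integral>\<^sup>+z. ennreal (\<rho> z) * indicator (neg_cone \<inter> ball 0 M) z \<partial>lebesgue)"
  have int: "integrable lebesgue \<rho>" and nonneg: "\<And>z. 0 \<le> \<rho> z"
    using \<rho> by (auto simp: radial_kernel_def)
  have [measurable]: "(\<lambda>z. ennreal (\<rho> z)) \<in> borel_measurable lebesgue" using int by auto
  have "neg_cone \<inter> ball 0 M \<in> sets lebesgue" using neg_cone_props(1) by (simp add: borel_open open_Int sets_completionI_sets)
  then have [measurable]: "indicator (neg_cone \<inter> ball 0 M) \<in> borel_measurable lebesgue" by simp
  define \<epsilon>0 where "\<epsilon>0 = min r (\<eta> / M)"
  have "0 < \<epsilon>0" using r C M by (simp add: \<epsilon>0_def)
  have "ennreal C * \<kappa> \<le> energy_eps X1 X2 \<Omega>1 \<Omega>2 \<rho> \<theta>1 \<theta>2 p \<epsilon> u" if \<epsilon>: "0 < \<epsilon>" "\<epsilon> < \<epsilon>0" for \<epsilon>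
  proof -
    have le: "\<epsilon> \<le> r" "\<epsilon> * M \<le> \<eta>" using \<epsilon> M by (auto simp: \<epsilon>0_def field_simps)
    have "ennreal C * \<kappa> = (\<integral>\<^sup>+z. ennreal C * (ennreal (\<rho> z) * indicator (neg_cone \<inter> ball 0 M) z) \<partial>lebesgue)"
      unfolding \<kappa>_def by (rule nn_integral_cmult[symmetric]) measurable
    also have "\<dots> = (\<integral>\<^sup>+z. ennreal (1 / \<epsilon> ^ DIM('a)) *
        (ennreal C * (ennreal (\<rho> (z /\<^sub>R \<epsilon>)) * indicator (neg_cone \<inter> ball 0 M) (z /\<^sub>R \<epsilon>))) \<partial>lebesgue)"
      by (rule nn_integral_lebesgue_rescale[OF _ \<epsilon>(1), symmetric]) measurable
    also have "\<dots> \<le> energy_eps X1 X2 \<Omega>1 \<Omega>2 \<rho> \<theta>1 \<theta>2 p \<epsilon> u"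
      unfolding energy_eps_def double_increment_def[symmetric]
    proof (rule nn_integral_mono)
      fix z
      let ?I = "\<integral>\<^sup>+x\<in>shrink X1 \<Omega>1 \<epsilon> + shrink X2 \<Omega>2 \<epsilon>.
           ennreal (double_increment X1 X2 \<theta>1 \<theta>2 u z x / norm z powr p) \<partial>lebesgue"
      show "ennreal (1 / \<epsilon> ^ DIM('a)) *
        (ennreal C * (ennreal (\<rho> (z /\<^sub>R \<epsilon>)) * indicator (neg_cone \<inter> ball 0 M) (z /\<^sub>R \<epsilon>)))
        \<le> ennreal (rescale \<rho> \<epsilon> z) * ?I"
      proof (cases "z /\<^sub>R \<epsilon> \<in> neg_cone \<inter> ball 0 M")
        case True
        then have "\<epsilon> *\<^sub>R (z /\<^sub>R \<epsilon>) \<in> neg_cone" using neg_cone_props(4)[OF \<epsilon>(1)] by blast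
        then have "z \<in> neg_cone" using \<epsilon> by simp
        moreover have "norm z < \<eta>"
        proof -
          have "norm z / \<epsilon> < M" using True \<epsilon> by (simp add: field_simps)
          then have "norm z < \<epsilon> * M" using \<epsilon> by (simp add: field_simps)
          with le show ?thesis by simp
        qed
        ultimately have "ennreal C \<le> ?I" using inner[OF \<epsilon>(1) le(1)] by blast
        then have "ennreal (rescale \<rho> \<epsilon> z) * ennreal C \<le> ennreal (rescale \<rho> \<epsilon> z) * ?I"
          by (rule mult_left_mono) simp
        with True show ?thesis
          by (simp only: rescale_eq[OF nonneg \<epsilon>(1)] indicator_simps mult_1_left mult_1_right mult_ac)
      qed simp
    qed
    finally show ?thesis .
  qed
  then have "\<forall>\<^sub>F \<epsilon> in at_right 0. ennreal C * \<kappa> \<le> energy_eps X1 X2 \<Omega>1 \<Omega>2 \<rho> \<theta>1 \<theta>2 p \<epsilon> u"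
    using \<open>0 < \<epsilon>0\<close> by (auto simp: eventually_at_right_field intro!: exI[of _ \<epsilon>0])
  then have "ennreal C * \<kappa> \<le> energy X1 X2 \<Omega>1 \<Omega>2 \<rho> \<theta>1 \<theta>2 p u"
    unfolding energy_def by (rule Liminf_bounded)
  moreover have "0 < ennreal C * \<kappa>" using C M by (simp add: \<kappa>_def ennreal_zero_less_mult_iff)
  ultimately show ?thesis by (rule less_le_trans[rotated])
qed

text \<open>The scaling behind the critical exponent \<open>q + m\<close>. The product of the powers of the increments is of
  order \<open>norm z powr q\<close> and is nonzero only if \<open>l (x - x0)\<close> lies in a set of measure of order
  \<open>norm z powr m\<close>. So the inner integral divided by \<open>norm z powr (q + m)\<close> stays bounded, and for small
  \<open>z\<close> in the cone it is bounded away from \<open>0\<close>.\<close>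

lemma energy_finite_pos:
  fixes l :: "'a \<Rightarrow> 'b::euclidean_space" and L :: "'b \<Rightarrow> 'a"
  assumes \<rho>: "radial_kernel \<rho>"
    and l: "linear l" "linear L" "\<And>y. l (L y) = y"
    and Q: "\<And>z. Q z \<in> sets borel" "\<And>z. z \<noteq> 0 \<Longrightarrow> emeasure lborel (Q z) \<le> ennreal (C * norm z powr m)" "0 \<le> C"
    and upper: "\<And>z x. z \<noteq> 0 \<Longrightarrow>
      double_increment X1 X2 \<theta>1 \<theta>2 u z x \<le> norm z powr q * indicator (Q z) (l (x - x0))"
    and P: "\<And>z. P z \<in> sets borel" "\<And>z. P z \<subseteq> cball 0 (norm z)"
      "\<And>z. z \<noteq> 0 \<Longrightarrow> ennreal (c * norm z powr m) \<le> emeasure lborel (P z)" "0 < c" "0 < d"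
    and lower: "\<And>z x. z \<in> neg_cone \<Longrightarrow> l (x - x0) \<in> P z \<Longrightarrow>
      d * norm z powr q \<le> double_increment X1 X2 \<theta>1 \<theta>2 u z x"
  shows "0 < energy X1 X2 \<Omega>1 \<Omega>2 \<rho> \<theta>1 \<theta>2 (q + m) u"
    and "energy X1 X2 \<Omega>1 \<Omega>2 \<rho> \<theta>1 \<theta>2 (q + m) u < \<infinity>"
proof -
  have powr_cancel: "norm z powr q / norm z powr (q + m) = norm z powr (- m)"
    "norm z powr (- m) * norm z powr m = 1" if "z \<noteq> 0" for z :: 'a
    using that by (simp_all add: powr_diff[symmetric] powr_add[symmetric])
  have "bounded (\<Omega>1 + \<Omega>2)" using bounded_plus[OF dom_bounded] by (simp add: set_plus_image)
  then obtain R where R: "\<Omega>1 + \<Omega>2 \<subseteq> ball x0 R" using bounded_subset_ballD by blast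
  obtain C' where C': "0 \<le> C'"
    "\<And>Q. Q \<in> sets borel \<Longrightarrow> emeasure lborel {x \<in> ball x0 R. l (x - x0) \<in> Q} \<le> ennreal C' * emeasure lborel Q"
    using emeasure_preimage_le[OF l, of x0 R] by blast
  have "energy X1 X2 \<Omega>1 \<Omega>2 \<rho> \<theta>1 \<theta>2 (q + m) u \<le> ennreal (C' * C)"
  proof (rule energy_le[OF \<rho>])
    fix \<epsilon> :: real and z :: 'a assume \<epsilon>: "0 < \<epsilon>"
    let ?A = "{x \<in> ball x0 R. l (x - x0) \<in> Q z}"
    have A: "?A \<in> sets borel" by (rule sets_preimage_ball[OF l Q(1)])
    show "(\<integral>\<^sup>+x\<in>shrink X1 \<Omega>1 \<epsilon> + shrink X2 \<Omega>2 \<epsilon>.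
           ennreal (double_increment X1 X2 \<theta>1 \<theta>2 u z x / norm z powr (q + m)) \<partial>lebesgue) \<le> ennreal (C' * C)"
    proof (cases "z = 0")
      case False
      have "(\<integral>\<^sup>+x\<in>shrink X1 \<Omega>1 \<epsilon> + shrink X2 \<Omega>2 \<epsilon>.
           ennreal (double_increment X1 X2 \<theta>1 \<theta>2 u z x / norm z powr (q + m)) \<partial>lebesgue)
        \<le> (\<integral>\<^sup>+x. ennreal (norm z powr (- m)) * indicator ?A x \<partial>lebesgue)"
      proof (rule nn_integral_mono)
        fix x
        show "ennreal (double_increment X1 X2 \<theta>1 \<theta>2 u z x / norm z powr (q + m)) *
            indicator (shrink X1 \<Omega>1 \<epsilon> + shrink X2 \<Omega>2 \<epsilon>) x
          \<le> ennreal (norm z powr (- m)) * indicator ?A x"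
        proof (cases "x \<in> shrink X1 \<Omega>1 \<epsilon> + shrink X2 \<Omega>2 \<epsilon>")
          case True
          then have "x \<in> ball x0 R" using shrink_subset[OF \<epsilon>] R by blast
          then have ind: "indicator ?A x = (indicator (Q z) (l (x - x0)) :: real)" by (auto simp: indicator_def)
          have "double_increment X1 X2 \<theta>1 \<theta>2 u z x / norm z powr (q + m)
              \<le> norm z powr q * indicator (Q z) (l (x - x0)) / norm z powr (q + m)"
            using upper[OF False] by (rule divide_right_mono) simp
          also have "\<dots> = norm z powr (- m) * indicator ?A x"
            unfolding ind powr_cancel(1)[OF False, symmetric] by simp
          finally have "ennreal (double_increment X1 X2 \<theta>1 \<theta>2 u z x / norm z powr (q + m))
              \<le> ennreal (norm z powr (- m) * indicator ?A x)" by (rule ennreal_leI)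
          then show ?thesis using True by (simp add: ennreal_mult ennreal_indicator)
        qed simp
      qed
      also have "\<dots> = ennreal (norm z powr (- m)) * emeasure lborel ?A"
        using A by (subst nn_integral_cmult_indicator) auto
      also have "\<dots> \<le> ennreal (norm z powr (- m)) * (ennreal C' * ennreal (C * norm z powr m))"
        by (intro mult_left_mono order_trans[OF C'(2)[OF Q(1)]] Q(2) False) auto
      also have "\<dots> = ennreal (C' * C * (norm z powr (- m) * norm z powr m))"
        using C' Q(3) by (simp add: ennreal_mult[symmetric] mult_ac)
      finally show ?thesis by (simp only: powr_cancel(2)[OF False] mult_1_right)
    qed simp
  qed
  then show "energy X1 X2 \<Omega>1 \<Omega>2 \<rho> \<theta>1 \<theta>2 (q + m) u < \<infinity>"
    by (rule le_less_trans) simp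
  obtain c' \<eta> where c': "0 < c'" "0 < \<eta>" "\<And>Q. Q \<in> sets borel \<Longrightarrow> Q \<subseteq> ball 0 \<eta> \<Longrightarrow>
      ennreal c' * emeasure lborel Q \<le> emeasure lborel {x \<in> ball x0 r. l (x - x0) \<in> Q}"
    using emeasure_preimage_ge[OF l r, of x0] by blast
  show "0 < energy X1 X2 \<Omega>1 \<Omega>2 \<rho> \<theta>1 \<theta>2 (q + m) u"
  proof (rule energy_pos[OF \<rho>, where C = "d * c' * c" and \<eta> = \<eta>])
    show "0 < d * c' * c" "0 < \<eta>" using c' P by auto
    fix \<epsilon> :: real and z :: 'a assume \<epsilon>: "0 < \<epsilon>" "\<epsilon> \<le> r" and z: "z \<in> neg_cone" "norm z < \<eta>"
    have z0: "z \<noteq> 0" using z by (auto simp: neg_cone_def)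
    let ?A = "{x \<in> ball x0 r. l (x - x0) \<in> P z}"
    have A: "?A \<in> sets borel" by (rule sets_preimage_ball[OF l P(1)])
    have "P z \<subseteq> ball 0 \<eta>" using P(2)[of z] z(2) by auto
    have "ennreal (d * c' * c) = ennreal (d * c' * c * (norm z powr (- m) * norm z powr m))"
      by (simp only: powr_cancel(2)[OF z0] mult_1_right)
    also have "\<dots> = ennreal (d * norm z powr (- m)) * (ennreal c' * ennreal (c * norm z powr m))"
      using c' P(4,5) by (simp add: ennreal_mult[symmetric] mult_ac)
    also have "\<dots> \<le> ennreal (d * norm z powr (- m)) * emeasure lborel ?A"
      by (intro mult_left_mono order_trans[OF mult_left_mono[OF P(3)[OF z0]] c'(3)[OF P(1)]] \<open>P z \<subseteq> ball 0 \<eta>\<close>) auto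
    also have "\<dots> = (\<integral>\<^sup>+x. ennreal (d * norm z powr (- m)) * indicator ?A x \<partial>lebesgue)"
      using A by (subst nn_integral_cmult_indicator) auto
    also have "\<dots> \<le> (\<integral>\<^sup>+x\<in>shrink X1 \<Omega>1 \<epsilon> + shrink X2 \<Omega>2 \<epsilon>.
           ennreal (double_increment X1 X2 \<theta>1 \<theta>2 u z x / norm z powr (q + m)) \<partial>lebesgue)"
    proof (rule nn_integral_mono)
      fix x
      show "ennreal (d * norm z powr (- m)) * indicator ?A x \<le>
        ennreal (double_increment X1 X2 \<theta>1 \<theta>2 u z x / norm z powr (q + m)) *
            indicator (shrink X1 \<Omega>1 \<epsilon> + shrink X2 \<Omega>2 \<epsilon>) x"
      proof (cases "x \<in> ?A")
        case True
        then have "x \<in> shrink X1 \<Omega>1 \<epsilon> + shrink X2 \<Omega>2 \<epsilon>" using ball_subset_shrink[OF \<epsilon>] by auto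
        moreover have "d * norm z powr q / norm z powr (q + m)
            \<le> double_increment X1 X2 \<theta>1 \<theta>2 u z x / norm z powr (q + m)"
          using lower[OF z(1), of x] True by (intro divide_right_mono) auto
        then have "d * norm z powr (- m) \<le> double_increment X1 X2 \<theta>1 \<theta>2 u z x / norm z powr (q + m)"
          by (simp only: times_divide_eq_right[symmetric] powr_cancel(1)[OF z0])
        ultimately show ?thesis using True by (simp only: indicator_simps mult_1_right ennreal_leI)
      qed simp
    qed
    finally show "ennreal (d * c' * c) \<le> (\<integral>\<^sup>+x\<in>shrink X1 \<Omega>1 \<epsilon> + shrink X2 \<Omega>2 \<epsilon>.
           ennreal (double_increment X1 X2 \<theta>1 \<theta>2 u z x / norm z powr (q + m)) \<partial>lebesgue)" .
  qed
qed

end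

section \<open>The two witnesses\<close>

lemma abs_inner_unit_le:
  fixes z e :: "'a::euclidean_space"
  shows "norm e = 1 \<Longrightarrow> \<bar>z \<bullet> e\<bar> \<le> norm z"
  using Cauchy_Schwarz_ineq2[of z e] by simp

lemma min_increment_both_nonzero:
  fixes s t a b :: real
  assumes "min (s + a) t - min s t \<noteq> 0" "min s (t + b) - min s t \<noteq> 0" "\<bar>a\<bar> \<le> d" "\<bar>b\<bar> \<le> d"
  shows "\<bar>s - t\<bar> \<le> d"
  using assms by (auto simp: min_def split: if_splits)

lemma emeasure_lborel_square:
  assumes "a \<le> b"
  shows "emeasure lborel ({a..b} \<times> {a..b::real}) = ennreal ((b - a)\<^sup>2)"
  using assms
  by (simp add: lborel_prod[symmetric] lborel.emeasure_pair_measure_Times ennreal_mult[symmetric] power2_eq_square)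

context split_domain
begin

text \<open>The coordinates along \<open>e\<close> and \<open>f\<close>, centred at \<open>x0\<close>.\<close>

definition coord1 :: "'a \<Rightarrow> real" where "coord1 x = (x - x0) \<bullet> e"
definition coord2 :: "'a \<Rightarrow> real" where "coord2 x = (x - x0) \<bullet> f"

lemma coord_add:
  "coord1 (x + component X1 X2 z) = coord1 x + z \<bullet> e" "coord2 (x + component X1 X2 z) = coord2 x"
  "coord1 (x + component X2 X1 z) = coord1 x" "coord2 (x + component X2 X1 z) = coord2 x + z \<bullet> f"
  using component_inner[of z] by (simp_all add: coord1_def coord2_def inner_diff_left inner_add_left)

lemma coord_shift:
  "coord1 (x + h *\<^sub>R e) = coord1 x + h" "coord2 (x + h *\<^sub>R e) = coord2 x"
  "coord1 (x + h *\<^sub>R f) = coord1 x" "coord2 (x + h *\<^sub>R f) = coord2 x + h"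
  "coord1 (x + (h *\<^sub>R e + h *\<^sub>R f)) = coord1 x + h" "coord2 (x + (h *\<^sub>R e + h *\<^sub>R f)) = coord2 x + h"
  by (simp_all add: coord1_def coord2_def inner_diff_left inner_add_left ef)

lemma coord_continuous: "continuous_on UNIV coord1" "continuous_on UNIV coord2"
  unfolding coord1_def[abs_def] coord2_def[abs_def] by (auto intro!: continuous_intros)

lemma coord_measurable [measurable]:
  "coord1 \<in> borel_measurable borel" "coord2 \<in> borel_measurable borel"
  using coord_continuous by (auto intro: borel_measurable_continuous_onI)

lemma inner_bounds: "\<bar>z \<bullet> e\<bar> \<le> norm z" "\<bar>z \<bullet> f\<bar> \<le> norm z"
  using abs_inner_unit_le e f by auto

text \<open>An open set of points whose two coordinates change from negative to positive under a shift by
  \<open>r / 2\<close>. There both witnesses have positive mixed difference of step \<open>r / 2\<close>.\<close>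

definition corner :: "'a set" where
  "corner = {x \<in> ball x0 r. - (r / 3) < coord1 x \<and> coord1 x < - (r / 6) \<and>
     - (r / 3) < coord2 x \<and> coord2 x < - (r / 6)}"

lemma corner: "open corner" "corner \<noteq> {}" "corner \<subseteq> ball x0 r"
proof -
  have "corner = ball x0 r \<inter> {x. - (r / 3) < coord1 x \<and> coord1 x < - (r / 6) \<and>
     - (r / 3) < coord2 x \<and> coord2 x < - (r / 6)}" by (auto simp: corner_def)
  moreover have "open {x. - (r / 3) < coord1 x \<and> coord1 x < - (r / 6) \<and>
     - (r / 3) < coord2 x \<and> coord2 x < - (r / 6)}"
    by (intro open_Collect_conj open_Collect_less coord_continuous continuous_on_const)
  ultimately show "open corner" by auto
  let ?x = "x0 + (- (r / 4) *\<^sub>R e + - (r / 4) *\<^sub>R f)"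
  have "norm (- (r / 4) *\<^sub>R e + - (r / 4) *\<^sub>R f) \<le> r / 4 + r / 4"
    using norm_triangle_ineq[of "- (r / 4) *\<^sub>R e" "- (r / 4) *\<^sub>R f"] r e f by simp
  moreover have "dist x0 (x0 + w) = norm w" for w by (simp add: dist_norm)
  ultimately have "?x \<in> ball x0 r" using r unfolding mem_ball by simp
  moreover have "coord1 ?x = - (r / 4)" "coord2 ?x = - (r / 4)"
    by (simp_all only: coord_shift) (simp_all add: coord1_def coord2_def)
  ultimately have "?x \<in> corner" using r unfolding corner_def by auto
  then show "corner \<noteq> {}" by blast
  show "corner \<subseteq> ball x0 r" by (auto simp: corner_def)
qed

text \<open>For \<open>min\<close> of the coordinates, both increments are at most \<open>norm z\<close>, and one of them vanishes outside
  a slab about the diagonal of width of order \<open>norm z\<close>: \<open>q = \<theta>1 + \<theta>2\<close> and \<open>m = 1\<close>.\<close>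

lemma witness_lipschitz:
  defines "u \<equiv> \<lambda>x. min (coord1 x) (coord2 x)"
  assumes \<rho>: "radial_kernel \<rho>" and \<theta>: "0 < \<theta>1" "0 < \<theta>2"
  shows "u \<in> Lip (\<Omega>1 + \<Omega>2)" "u \<notin> S_space X1 X2 \<Omega>1 \<Omega>2" "mu_nonzero X1 X2 (\<Omega>1 + \<Omega>2) u"
    "0 < energy X1 X2 \<Omega>1 \<Omega>2 \<rho> \<theta>1 \<theta>2 (1 + (\<theta>1 + \<theta>2)) u"
    "energy X1 X2 \<Omega>1 \<Omega>2 \<rho> \<theta>1 \<theta>2 (1 + (\<theta>1 + \<theta>2)) u < \<infinity>"
proof -
  have "1-lipschitz_on (\<Omega>1 + \<Omega>2) u"
  proof (rule lipschitz_onI)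
    fix x y
    have "\<bar>coord1 x - coord1 y\<bar> \<le> dist x y" "\<bar>coord2 x - coord2 y\<bar> \<le> dist x y"
      using inner_bounds[of "x - y"]
      by (simp_all add: coord1_def coord2_def dist_norm inner_diff_left)
    then show "dist (u x) (u y) \<le> 1 * dist x y"
      unfolding u_def dist_real_def by (auto simp: min_def split: if_splits)
  qed simp
  then show "u \<in> Lip (\<Omega>1 + \<Omega>2)" by (auto simp: Lip_def)
  have md: "mixed_diff e f h u x = min (coord1 x + h) (coord2 x + h) - min (coord1 x + h) (coord2 x)
      - min (coord1 x) (coord2 x + h) + min (coord1 x) (coord2 x)" for h x
    by (simp add: mixed_diff_def u_def coord_shift)
  have md_nonneg: "0 \<le> mixed_diff e f h u x" if "0 \<le> h" for h x
    unfolding md using that by (auto simp: min_def)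
  have md_pos: "0 < mixed_diff e f (r / 2) u x" if "x \<in> corner" for x
    unfolding md using that r by (auto simp: corner_def min_def)
  show "u \<notin> S_space X1 X2 \<Omega>1 \<Omega>2"
    using md_pos r by (intro not_in_S_space[OF corner, where h = "r / 2"]) fastforce+
  show "mu_nonzero X1 X2 (\<Omega>1 + \<Omega>2) u"
  proof (rule mu_nonzero_if_mixed_diff_nonneg[OF _ _ corner, where h = "r / 2" and M = "2 * r"])
    show "u \<in> borel_measurable borel" unfolding u_def by measurable
    show "\<bar>u x\<bar> \<le> 2 * r" if "x \<in> cball x0 (2 * r)" for x
    proof -
      have "\<bar>coord1 x\<bar> \<le> 2 * r" "\<bar>coord2 x\<bar> \<le> 2 * r"
        using inner_bounds[of "x - x0"] that
        by (simp_all add: coord1_def coord2_def dist_norm norm_minus_commute)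
      then show ?thesis by (auto simp: u_def min_def)
    qed
  qed (use r md_nonneg md_pos in auto)
  let ?w = "double_increment X1 X2 \<theta>1 \<theta>2 u"
  have w: "?w z x = \<bar>min (coord1 x + z \<bullet> e) (coord2 x) - min (coord1 x) (coord2 x)\<bar> powr \<theta>1 *
      \<bar>min (coord1 x) (coord2 x + z \<bullet> f) - min (coord1 x) (coord2 x)\<bar> powr \<theta>2" for z x
    by (simp add: double_increment_def u_def coord_add)
  define l where "l y = y \<bullet> (e - f)" for y
  have l_coord: "l (x - x0) = coord1 x - coord2 x" for x
    by (simp add: l_def coord1_def coord2_def inner_diff_right)
  have l: "linear l" "linear (\<lambda>\<sigma>. \<sigma> *\<^sub>R e)" "\<And>\<sigma>. l (\<sigma> *\<^sub>R e) = \<sigma>"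
    by (auto simp: l_def inner_diff_right ef linear_iff inner_add_left scaleR_add_left algebra_simps)
  have upper: "?w z x \<le> norm z powr (\<theta>1 + \<theta>2) * indicator {- norm z..norm z} (l (x - x0))" for z x
  proof (cases "?w z x = 0")
    case False
    then have "\<bar>coord1 x - coord2 x\<bar> \<le> norm z"
      using inner_bounds[of z] by (intro min_increment_both_nonzero[of _ "z \<bullet> e" _ "z \<bullet> f"]) (auto simp: w)
    then have ind: "indicator {- norm z..norm z} (l (x - x0)) = (1::real)"
      by (auto simp: l_coord indicator_def)
    have "?w z x \<le> norm z powr \<theta>1 * norm z powr \<theta>2"
      unfolding w
    proof (intro mult_mono powr_mono2)
      show "\<bar>min (coord1 x + z \<bullet> e) (coord2 x) - min (coord1 x) (coord2 x)\<bar> \<le> norm z"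
        "\<bar>min (coord1 x) (coord2 x + z \<bullet> f) - min (coord1 x) (coord2 x)\<bar> \<le> norm z"
        using inner_bounds[of z] by (auto simp: min_def)
    qed (use \<theta> in auto)
    then show ?thesis by (simp add: ind powr_add)
  qed simp
  \<comment> \<open>On this slab, a shift in the cone lowers the minimum by at least \<open>norm z / 4\<close> in either component.\<close>
  have lower: "(1 / 4) powr (\<theta>1 + \<theta>2) * norm z powr (\<theta>1 + \<theta>2) \<le> ?w z x"
    if "z \<in> neg_cone" "l (x - x0) \<in> {- (norm z / 4)..norm z / 4}" for z x
  proof -
    have "z \<bullet> e < - norm z / 2" "z \<bullet> f < - norm z / 2"
      "- (norm z / 4) \<le> coord1 x - coord2 x" "coord1 x - coord2 x \<le> norm z / 4"
      using that by (auto simp: neg_cone_def l_coord)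
    then have "norm z / 4 \<le> \<bar>min (coord1 x + z \<bullet> e) (coord2 x) - min (coord1 x) (coord2 x)\<bar>"
      "norm z / 4 \<le> \<bar>min (coord1 x) (coord2 x + z \<bullet> f) - min (coord1 x) (coord2 x)\<bar>"
      using norm_ge_zero[of z] by (auto simp: min_def)
    then have "(norm z / 4) powr \<theta>1 * (norm z / 4) powr \<theta>2 \<le> ?w z x"
      unfolding w using \<theta> by (intro mult_mono powr_mono2) auto
    then show ?thesis by (simp add: powr_add[symmetric] powr_mult[symmetric])
  qed
  have "0 < energy X1 X2 \<Omega>1 \<Omega>2 \<rho> \<theta>1 \<theta>2 ((\<theta>1 + \<theta>2) + 1) u \<and>
    energy X1 X2 \<Omega>1 \<Omega>2 \<rho> \<theta>1 \<theta>2 ((\<theta>1 + \<theta>2) + 1) u < \<infinity>"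
    by (intro conjI energy_finite_pos[OF \<rho> l, where Q = "\<lambda>z. {- norm z..norm z}" and C = 2 and m = 1
        and q = "\<theta>1 + \<theta>2" and P = "\<lambda>z. {- (norm z / 4)..norm z / 4}" and c = "1 / 2"
        and d = "(1 / 4) powr (\<theta>1 + \<theta>2)"] upper lower) auto
  then show "0 < energy X1 X2 \<Omega>1 \<Omega>2 \<rho> \<theta>1 \<theta>2 (1 + (\<theta>1 + \<theta>2)) u"
    "energy X1 X2 \<Omega>1 \<Omega>2 \<rho> \<theta>1 \<theta>2 (1 + (\<theta>1 + \<theta>2)) u < \<infinity>"
    by (simp_all only: add.commute[of 1])
qed

text \<open>For the indicator of a quadrant, both increments are \<open>0\<close> or of absolute value \<open>1\<close>, and one of them
  vanishes outside a square of side of order \<open>norm z\<close> in the two coordinates: \<open>q = 0\<close> and \<open>m = 2\<close>.\<close>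

lemma witness_bounded:
  defines "u \<equiv> \<lambda>x. if 0 < coord1 x \<and> 0 < coord2 x then 1 else 0 :: real"
  assumes \<rho>: "radial_kernel \<rho>" and \<theta>: "0 < \<theta>1" "0 < \<theta>2"
  shows "u \<in> Linfty (\<Omega>1 + \<Omega>2)" "u \<notin> S_space X1 X2 \<Omega>1 \<Omega>2" "mu_nonzero X1 X2 (\<Omega>1 + \<Omega>2) u"
    "0 < energy X1 X2 \<Omega>1 \<Omega>2 \<rho> \<theta>1 \<theta>2 2 u"
    "energy X1 X2 \<Omega>1 \<Omega>2 \<rho> \<theta>1 \<theta>2 2 u < \<infinity>"
proof -
  have u: "u \<in> borel_measurable borel" unfolding u_def by measurable
  have u_le: "\<bar>u x\<bar> \<le> 1" for x by (simp add: u_def)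
  have "u \<in> borel_measurable (lebesgue_on (\<Omega>1 + \<Omega>2))"
    using u by (intro measurable_restrict_space1 measurable_completion) simp
  with u_le show "u \<in> Linfty (\<Omega>1 + \<Omega>2)"
    by (auto simp: Linfty_def Lmeas_def intro!: exI[of _ 1])
  have md: "mixed_diff e f h u x = (if 0 < coord1 x + h \<and> 0 < coord2 x + h then 1 else 0)
      - (if 0 < coord1 x + h \<and> 0 < coord2 x then 1 else 0)
      - (if 0 < coord1 x \<and> 0 < coord2 x + h then 1 else 0)
      + (if 0 < coord1 x \<and> 0 < coord2 x then 1 else 0)" for h x
    by (simp add: mixed_diff_def u_def coord_shift)
  have md_nonneg: "0 \<le> mixed_diff e f h u x" if "0 \<le> h" for h x
    unfolding md using that by auto
  have md_pos: "0 < mixed_diff e f (r / 2) u x" if "x \<in> corner" for x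
    unfolding md using that r by (auto simp: corner_def)
  show "u \<notin> S_space X1 X2 \<Omega>1 \<Omega>2"
    using md_pos r by (intro not_in_S_space[OF corner, where h = "r / 2"]) fastforce+
  show "mu_nonzero X1 X2 (\<Omega>1 + \<Omega>2) u"
    by (rule mu_nonzero_if_mixed_diff_nonneg[OF u u_le corner, where h = "r / 2"])
       (use r md_nonneg md_pos in auto)
  let ?w = "double_increment X1 X2 \<theta>1 \<theta>2 u"
  define l where "l y = (y \<bullet> e, y \<bullet> f)" for y
  have l_coord: "l (x - x0) = (coord1 x, coord2 x)" for x
    by (simp add: l_def coord1_def coord2_def)
  have l: "linear l" "linear (\<lambda>p. fst p *\<^sub>R e + snd p *\<^sub>R f)" "\<And>p. l (fst p *\<^sub>R e + snd p *\<^sub>R f) = p"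
    by (auto simp: l_def ef linear_iff inner_add_left scaleR_add_left algebra_simps)
  have upper: "?w z x \<le> norm z powr 0 * indicator ({- norm z..norm z} \<times> {- norm z..norm z}) (l (x - x0))"
    if "z \<noteq> 0" for z x
  proof -
    have "?w z x \<le> (if \<bar>coord1 x\<bar> \<le> norm z \<and> \<bar>coord2 x\<bar> \<le> norm z then 1 else 0)"
      using inner_bounds[of z] by (auto simp: double_increment_def u_def coord_add)
    with that show ?thesis by (auto simp: l_coord indicator_def split: if_splits)
  qed
  \<comment> \<open>On this square, a shift in the cone makes either coordinate negative, so both increments are \<open>-1\<close>.\<close>
  have lower: "1 * norm z powr 0 \<le> ?w z x"
    if "z \<in> neg_cone" "l (x - x0) \<in> {norm z / 4..norm z / 2} \<times> {norm z / 4..norm z / 2}" for z x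
  proof -
    have "z \<bullet> e < - norm z / 2" "z \<bullet> f < - norm z / 2" "0 < norm z" using that by (auto simp: neg_cone_def)
    moreover have "norm z / 4 \<le> coord1 x" "coord1 x \<le> norm z / 2" "norm z / 4 \<le> coord2 x" "coord2 x \<le> norm z / 2"
      using that by (auto simp: l_coord)
    ultimately have "0 < coord1 x" "0 < coord2 x" "coord1 x + z \<bullet> e < 0" "coord2 x + z \<bullet> f < 0"
      by linarith+
    with \<open>0 < norm z\<close> show ?thesis by (simp add: double_increment_def u_def coord_add)
  qed
  have P: "{norm z / 4..norm z / 2} \<times> {norm z / 4..norm z / 2} \<subseteq> cball 0 (norm z)" for z :: 'a
  proof safe
    fix s t assume "s \<in> {norm z / 4..norm z / 2}" "t \<in> {norm z / 4..norm z / 2}"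
    then show "(s, t) \<in> cball 0 (norm z)"
      using norm_Pair_le[of s t] norm_ge_zero[of z] by auto
  qed
  have "0 < energy X1 X2 \<Omega>1 \<Omega>2 \<rho> \<theta>1 \<theta>2 (0 + 2) u \<and>
    energy X1 X2 \<Omega>1 \<Omega>2 \<rho> \<theta>1 \<theta>2 (0 + 2) u < \<infinity>"
    by (intro conjI energy_finite_pos[OF \<rho> l, where Q = "\<lambda>z. {- norm z..norm z} \<times> {- norm z..norm z}"
        and C = 4 and m = 2 and q = 0 and P = "\<lambda>z. {norm z / 4..norm z / 2} \<times> {norm z / 4..norm z / 2}"
        and c = "1 / 16" and d = 1] upper lower P)
       (auto simp: emeasure_lborel_square borel_Times power2_eq_square)
  then show "0 < energy X1 X2 \<Omega>1 \<Omega>2 \<rho> \<theta>1 \<theta>2 2 u"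
    "energy X1 X2 \<Omega>1 \<Omega>2 \<rho> \<theta>1 \<theta>2 2 u < \<infinity>"
    by simp_all
qed

end

lemma unit_vector_in_subspace:
  fixes X :: "'a::euclidean_space set"
  assumes "subspace X" "dim X \<ge> 1"
  obtains v where "v \<in> X" "norm v = 1"
proof -
  obtain x where x: "x \<in> X" "x \<noteq> 0" using assms(2) dim_eq_0[of X] by fastforce
  then have "x /\<^sub>R norm x \<in> X" "norm (x /\<^sub>R norm x) = 1"
    using assms(1) by (auto intro: subspace_scale)
  then show ?thesis using that by blast
qed

lemma open_sum_orthogonal:
  fixes X1 X2 :: "'a::euclidean_space set"
  assumes sub: "subspace X1" "subspace X2" and sum: "X1 + X2 = UNIV"
    and orth: "\<And>x y. x \<in> X1 \<Longrightarrow> y \<in> X2 \<Longrightarrow> orthogonal x y"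
    and op: "openin (top_of_set X1) \<Omega>1" "openin (top_of_set X2) \<Omega>2"
  shows "open (\<Omega>1 + \<Omega>2)"
  unfolding open_contains_ball
proof
  fix x assume "x \<in> \<Omega>1 + \<Omega>2"
  then obtain a b where ab: "a \<in> \<Omega>1" "b \<in> \<Omega>2" "x = a + b" by (auto elim: set_plus_elim)
  obtain d1 where d1: "d1 > 0" "ball a d1 \<inter> X1 \<subseteq> \<Omega>1"
    using op(1) ab(1) by (auto simp: openin_contains_ball)
  obtain d2 where d2: "d2 > 0" "ball b d2 \<inter> X2 \<subseteq> \<Omega>2"
    using op(2) ab(2) by (auto simp: openin_contains_ball)
  have aX: "a \<in> X1" "b \<in> X2" using op ab openin_imp_subset by blast+
  have "ball x (min d1 d2) \<subseteq> \<Omega>1 + \<Omega>2"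
  proof
    fix y assume y: "y \<in> ball x (min d1 d2)"
    have "y \<in> X1 + X2" using sum by simp
    then obtain a' b' where ab': "a' \<in> X1" "b' \<in> X2" "y = a' + b'" by (auto elim: set_plus_elim)
    have "orthogonal (a - a') (b - b')"
      using orth ab' aX sub by (auto intro: subspace_diff)
    then have "(norm (x - y))\<^sup>2 = (norm (a - a'))\<^sup>2 + (norm (b - b'))\<^sup>2"
      using norm_add_Pythagorean[of "a - a'" "b - b'"] by (simp add: ab ab' algebra_simps)
    then have "norm (a - a') \<le> norm (x - y)" "norm (b - b') \<le> norm (x - y)"
      by (simp_all add: power2_le_imp_le)
    then have "a' \<in> \<Omega>1" "b' \<in> \<Omega>2"
      using y d1(2) d2(2) ab' by (auto simp: dist_norm)
    then show "y \<in> \<Omega>1 + \<Omega>2" using ab' by (auto intro: set_plus_intro)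
  qed
  then show "\<exists>d>0. ball x d \<subseteq> \<Omega>1 + \<Omega>2" using d1 d2 by (intro exI[of _ "min d1 d2"]) auto
qed

theorem proposition15:
  fixes X1 X2 \<Omega>1 \<Omega>2 \<Omega> :: "'a::euclidean_space set"
    and \<rho> :: "'a \<Rightarrow> real"
    and \<theta>1 \<theta>2 \<theta> :: real
  assumes "subspace X1" "subspace X2"
    and "dim X1 \<ge> 1" "dim X2 \<ge> 1"
    and "X1 + X2 = UNIV"
    and "\<And>x y. x \<in> X1 \<Longrightarrow> y \<in> X2 \<Longrightarrow> orthogonal x y"
    and "openin (top_of_set X1) \<Omega>1" "\<Omega>1 \<noteq> {}" "bounded \<Omega>1" "connected \<Omega>1"
    and "openin (top_of_set X2) \<Omega>2" "\<Omega>2 \<noteq> {}" "bounded \<Omega>2" "connected \<Omega>2"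
    and "\<Omega> = \<Omega>1 + \<Omega>2"
    and "radial_kernel \<rho>"
    and "\<theta>1 > 0" "\<theta>2 > 0" "\<theta> = \<theta>1 + \<theta>2"
  shows
    "(\<exists>u \<in> Lip \<Omega> - S_space X1 X2 \<Omega>1 \<Omega>2.
        0 < energy X1 X2 \<Omega>1 \<Omega>2 \<rho> \<theta>1 \<theta>2 (1 + \<theta>) u \<and>
        energy X1 X2 \<Omega>1 \<Omega>2 \<rho> \<theta>1 \<theta>2 (1 + \<theta>) u < \<infinity> \<and>
        mu_nonzero X1 X2 \<Omega> u) \<and>
     (\<exists>u \<in> Linfty \<Omega> - S_space X1 X2 \<Omega>1 \<Omega>2.
        0 < energy X1 X2 \<Omega>1 \<Omega>2 \<rho> \<theta>1 \<theta>2 2 u \<and>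
        energy X1 X2 \<Omega>1 \<Omega>2 \<rho> \<theta>1 \<theta>2 2 u < \<infinity> \<and>
        mu_nonzero X1 X2 \<Omega> u)"
proof -
  obtain e where e: "e \<in> X1" "norm e = 1" using unit_vector_in_subspace assms(1,3) by blast
  obtain f where f: "f \<in> X2" "norm f = 1" using unit_vector_in_subspace assms(2,4) by blast
  have op: "open (\<Omega>1 + \<Omega>2)" by (rule open_sum_orthogonal) fact+
  obtain a b where "a \<in> \<Omega>1" "b \<in> \<Omega>2" using assms(8,12) by blast
  then have "a + b \<in> \<Omega>1 + \<Omega>2" by (rule set_plus_intro)
  then obtain R where R: "R > 0" "cball (a + b) R \<subseteq> \<Omega>1 + \<Omega>2"
    using op open_contains_cball by blast
  have "\<Omega>1 \<subseteq> X1" "\<Omega>2 \<subseteq> X2" using assms(7,11) openin_imp_subset by blast+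
  then interpret split_domain X1 X2 \<Omega>1 \<Omega>2 e f "a + b" "R / 2"
    by unfold_locales (use assms e f op R in auto)
  show ?thesis
    unfolding \<open>\<Omega> = \<Omega>1 + \<Omega>2\<close> \<open>\<theta> = \<theta>1 + \<theta>2\<close>
    using witness_lipschitz[OF assms(16-18)] witness_bounded[OF assms(16-18)] by blast
qed

end
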